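(* Let $X$ be a Hilbert space, let $A$ be the infinitesimal generator of a linear $C_0$-semigroup of contractions $(S(t))_{t\ge0}$ on $X$, and let $B\in\mathcal{L}(X,X_{-1})$. Let $\mathfrak{X}\oplus\mathfrak{X}_{-1}$ (with $\mathfrak{X}=X$) be a direct sum in $X_{-1}$ that is an admissible decomposition for the pair $(A_{-1},-\rho B)$ for every sufficiently small $\rho>0$. Assume that for some $T>0$ the operator $B$ is $p$-admissible for some $1<p<\infty$, i.e. $$\int_0^T S_{-1}(T-s)Bu(s)\,ds\in X,\qquad\forall u\in L^p(0,T;X),$$ and that for some $\delta>0$ $$\int_0^T \mathrm{Re}\,\langle {}_XB\,S(t)x,\,S(t)x\rangle_X\,dt\ \ge\ \delta\,\|S(T)x\|_X^2,\qquad\forall x\in X.$$ Then there is a $\rho_1>0$ such that for all $\rho\in(0,\rho_1)$ the system $\dot x(t)=Ax(t)-\rho Bx(t)$ $(t>0)$, $x(0)=x_0$, is exponentially stable on $X$; that is, for each such $\rho$ there exist constants $K,\sigma>0$ such that for every $x_0\in X$ the mild solution satisfies $\|x(t)\|_X\le Ke^{-\sigma t}\|x_0\|_X$ for all $t\ge0$.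
   Context: $X$ is a Hilbert space with inner product $\langle\cdot,\cdot\rangle_X$ and norm $\|\cdot\|_X$. Extrapolation space: fix $\lambda$ in the resolvent set of $A$. $X_{-1}$ is the completion of $X$ for the norm $\|x\|_{-1}:=\|(\lambda I-A)^{-1}x\|_X$ (different $\lambda$ give equivalent norms); $X$ embeds continuously and densely in it. $A$ extends to an operator $A_{-1}\in\mathcal{L}(X,X_{-1})$, and $S(t)$ extends to a $C_0$-semigroup $S_{-1}(t)$ on $X_{-1}$ with generator $A_{-1}$, whose domain is $D(A_{-1})=X$. The admissibility integral is $X_{-1}$-valued. Range decompositions: let $\mathfrak{X}\oplus\mathfrak{X}_{-1}$ be a direct sum of subspaces in $X_{-1}$, where $\mathfrak{X}$ is the image of $X$ under the canonical injection $X\hookrightarrow X_{-1}$ (identified with $X$). For $C\in\mathcal{L}(X,X_{-1})$ with range $\mathrm{rg}(C)\subset\mathfrak{X}\oplus\mathfrak{X}_{-1}$, set ${}_XC:=P_{\mathfrak{X}}C$, where $P_{\mathfrak{X}}$ is the projection onto $\mathfrak{X}$ along $\mathfrak{X}_{-1}$ in $\mathfrak{X}\oplus\mathfrak{X}_{-1}$. For $K,L\in\mathcal{L}(X,X_{-1})$, the decomposition $\mathfrak{X}\oplus\mathfrak{X}_{-1}$ is called admissible for $(K,L)$ if: (a) $\mathrm{rg}(K)\subset\mathfrak{X}\oplus\mathfrak{X}_{-1}$ and $\mathrm{rg}(L)\subset\mathfrak{X}\oplus\mathfrak{X}_{-1}$; (b) ${}_XK$ is dissipative on $D((K+L)|_X):=\{x\in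 X: Kx+Lx\in X\}$, i.e. $\mathrm{Re}\,\langle {}_XKx,x\rangle_X\le 0$ for all $x$ in this set; (c) ${}_XL\in\mathcal{L}(X)$. Solutions: when $B$ is $p$-admissible, for every $\rho>0$ the part $(A_{-1}-\rho B)|_X$ of $A_{-1}-\rho B$ in $X$, with domain $\{x\in X:(A_{-1}-\rho B)x\in X\}$, generates a $C_0$-semigroup $(T(t))_{t\ge0}$ on $X$. The mild solution of the system with initial state $x_0\in X$ is $x(t)=T(t)x_0$; it satisfies $x(t)=S(t)x_0-\rho\int_0^tS_{-1}(t-s)Bx(s)\,ds$ for $t\ge0$. *)

theory Defs
  imports "HOL-Analysis.Analysis"
begin

class complex_normed_vector = real_normed_vector +
  fixes scaleC :: "complex \<Rightarrow> 'a \<Rightarrow> 'a"  (infixr "*\<^sub>C" 75)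
  assumes scaleC_add_right: "a *\<^sub>C (x + y) = a *\<^sub>C x + a *\<^sub>C y"
    and scaleC_add_left: "(a + b) *\<^sub>C x = a *\<^sub>C x + b *\<^sub>C x"
    and scaleC_scaleC: "a *\<^sub>C (b *\<^sub>C x) = (a * b) *\<^sub>C x"
    and scaleC_of_real: "complex_of_real r *\<^sub>C x = r *\<^sub>R x"
    and norm_scaleC: "norm (a *\<^sub>C x) = cmod a * norm x"

class complex_banach = complex_normed_vector + banach

class complex_hilbert = complex_banach +
  fixes cinner :: "'a \<Rightarrow> 'a \<Rightarrow> complex"
  assumes cinner_add_left: "cinner (x + y) z = cinner x z + cinner y z"
    and cinner_scaleC_left: "cinner (a *\<^sub>C x) y = a * cinner x y"
    and cinner_commute: "cinner x y = cnj (cinner y x)"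
    and norm_eq_sqrt_cinner: "norm x = sqrt (Re (cinner x x))"

instantiation complex :: complex_hilbert
begin
definition "scaleC a (x::complex) = a * x"
definition "cinner x (y::complex) = x * cnj y"
instance
proof
  fix a b x y z :: complex and r :: real
  show "a *\<^sub>C (x + y) = a *\<^sub>C x + a *\<^sub>C y" "(a + b) *\<^sub>C x = a *\<^sub>C x + b *\<^sub>C x"
    "a *\<^sub>C (b *\<^sub>C x) = (a * b) *\<^sub>C x" "complex_of_real r *\<^sub>C x = r *\<^sub>R x"
    "norm (a *\<^sub>C x) = cmod a * norm x"
    by (simp_all add: scaleC_complex_def ring_distribs mult.assoc scaleR_conv_of_real norm_mult)
  show "cinner (x + y) z = cinner x z + cinner y z" "cinner (a *\<^sub>C x) y = a * cinner x y"
    "cinner x y = cnj (cinner y x)"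
    by (simp_all add: cinner_complex_def scaleC_complex_def ring_distribs mult.assoc mult.commute)
  show "norm x = sqrt (Re (cinner x x))"
    by (simp add: cinner_complex_def cmod_def power2_eq_square)
qed
end

definition bounded_clinear :: "('a::complex_normed_vector \<Rightarrow> 'b::complex_normed_vector) \<Rightarrow> bool"
  where "bounded_clinear f \<longleftrightarrow> bounded_linear f \<and> (\<forall>a x. f (a *\<^sub>C x) = a *\<^sub>C f x)"

definition csubspace :: "'a::complex_normed_vector set \<Rightarrow> bool"
  where "csubspace W \<longleftrightarrow> subspace W \<and> (\<forall>a. \<forall>w\<in>W. a *\<^sub>C w \<in> W)"

(* Only the values S t with t >= 0 are meaningful. *)
definition C0_semigroup :: "(real \<Rightarrow> 'x::complex_normed_vector \<Rightarrow> 'x) \<Rightarrow> bool"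
  where "C0_semigroup S \<longleftrightarrow>
    (\<forall>t\<ge>0. bounded_clinear (S t)) \<and> S 0 = id \<and>
    (\<forall>s\<ge>0. \<forall>t\<ge>0. S (s + t) = S s \<circ> S t) \<and>
    (\<forall>x. ((\<lambda>t. S t x) \<longlongrightarrow> x) (at_right 0))"

definition contraction_semigroup :: "(real \<Rightarrow> 'x::complex_normed_vector \<Rightarrow> 'x) \<Rightarrow> bool"
  where "contraction_semigroup S \<longleftrightarrow> C0_semigroup S \<and> (\<forall>t\<ge>0. \<forall>x. norm (S t x) \<le> norm x)"

(* Unbounded operators are represented by their graphs. *)
definition generator :: "(real \<Rightarrow> 'x::complex_normed_vector \<Rightarrow> 'x) \<Rightarrow> ('x \<times> 'x) set"
  where "generator S = {(x, y). ((\<lambda>h. (S h x - x) /\<^sub>R h) \<longlongrightarrow> y) (at_right 0)}"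

(* R is the bounded everywhere defined inverse of lam I - A. *)
definition is_resolvent ::
    "('x \<times> 'x) set \<Rightarrow> complex \<Rightarrow> ('x::complex_normed_vector \<Rightarrow> 'x) \<Rightarrow> bool"
  where "is_resolvent A lam R \<longleftrightarrow> bounded_clinear R \<and>
    (\<forall>z x. R z = x \<longleftrightarrow> (\<exists>y. (x, y) \<in> A \<and> lam *\<^sub>C x - y = z))"

definition resolvent_set :: "('x::complex_normed_vector \<times> 'x) set \<Rightarrow> complex set"
  where "resolvent_set A = {lam. \<exists>R. is_resolvent A lam R}"

definition resolvent :: "('x::complex_normed_vector \<times> 'x) set \<Rightarrow> complex \<Rightarrow> 'x \<Rightarrow> 'x"
  where "resolvent A lam = (THE R. is_resolvent A lam R)"

(* The Banach space 'y with the canonical injection j is the completion of 'x for the norm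
   x |-> norm (resolvent A lam x). It is determined by A and lam up to isometric isomorphism. *)
definition extrapolation_space ::
    "('x \<times> 'x) set \<Rightarrow> complex \<Rightarrow> ('x::complex_banach \<Rightarrow> 'y::complex_banach) \<Rightarrow> bool"
  where "extrapolation_space A lam j \<longleftrightarrow> lam \<in> resolvent_set A \<and> bounded_clinear j \<and>
    (\<forall>x. norm (j x) = norm (resolvent A lam x)) \<and> closure (range j) = UNIV"

(* Such extensions exist and are unique on an extrapolation space, because the domain of A
   is dense in 'x and range j is dense in 'y. *)
definition operator_extension ::
    "('x::complex_banach \<Rightarrow> 'y::complex_banach) \<Rightarrow> ('x \<times> 'x) set \<Rightarrow> ('x \<Rightarrow> 'y) \<Rightarrow> bool"
  where "operator_extension j A Am1 \<longleftrightarrow> bounded_clinear Am1 \<and> (\<forall>(x, y)\<in>A. Am1 x = j y)"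

definition semigroup_extension ::
    "('x::complex_banach \<Rightarrow> 'y::complex_banach) \<Rightarrow> (real \<Rightarrow> 'x \<Rightarrow> 'x) \<Rightarrow>
      (real \<Rightarrow> 'y \<Rightarrow> 'y) \<Rightarrow> bool"
  where "semigroup_extension j S Sm1 \<longleftrightarrow>
    (\<forall>t\<ge>0. bounded_clinear (Sm1 t) \<and> (\<forall>x. Sm1 t (j x) = j (S t x)))"

(* The part in 'x of an operator C from 'x to 'y, as a graph. *)
definition part_in :: "('x \<Rightarrow> 'y) \<Rightarrow> ('x \<Rightarrow> 'y) \<Rightarrow> ('x \<times> 'x) set"
  where "part_in j C = {(x, y). C x = j y}"

(* The sum of range j and W is algebraic: range j is dense and in general not closed. *)
definition direct_decomposition ::
    "('x::complex_banach \<Rightarrow> 'y::complex_banach) \<Rightarrow> 'y set \<Rightarrow> bool"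
  where "direct_decomposition j W \<longleftrightarrow> csubspace W \<and> range j \<inter> W = {0}"

definition sum_space :: "('x::complex_banach \<Rightarrow> 'y::complex_banach) \<Rightarrow> 'y set \<Rightarrow> 'y set"
  where "sum_space j W = {j x + w | x w. w \<in> W}"

(* The projection onto range j along W, composed with the inverse of j. *)
definition X_proj :: "('x::complex_banach \<Rightarrow> 'y::complex_banach) \<Rightarrow> 'y set \<Rightarrow> 'y \<Rightarrow> 'x"
  where "X_proj j W z = (THE x. \<exists>w\<in>W. z = j x + w)"

definition X_comp ::
    "('x::complex_banach \<Rightarrow> 'y::complex_banach) \<Rightarrow> 'y set \<Rightarrow> ('x \<Rightarrow> 'y) \<Rightarrow> 'x \<Rightarrow> 'x"
  where "X_comp j W C = (\<lambda>x. X_proj j W (C x))"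

definition admissible_decomposition ::
    "('x::complex_hilbert \<Rightarrow> 'y::complex_banach) \<Rightarrow> 'y set \<Rightarrow> ('x \<Rightarrow> 'y) \<Rightarrow> ('x \<Rightarrow> 'y) \<Rightarrow> bool"
  where "admissible_decomposition j W K L \<longleftrightarrow>
    range K \<subseteq> sum_space j W \<and> range L \<subseteq> sum_space j W \<and>
    (\<forall>x. K x + L x \<in> range j \<longrightarrow> Re (cinner (X_comp j W K x) x) \<le> 0) \<and>
    bounded_clinear (X_comp j W L)"

(* 'x need not be separable, so Borel measurability does not suffice here. *)
definition strongly_measurable :: "'s measure \<Rightarrow> ('s \<Rightarrow> 'x::real_normed_vector) \<Rightarrow> bool"
  where "strongly_measurable M u \<longleftrightarrow>
    (\<exists>f. (\<forall>n::nat. simple_function M (f n)) \<and> (AE s in M. (\<lambda>n. f n s) \<longlonglongrightarrow> u s))"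

definition Lp_functions :: "real \<Rightarrow> real \<Rightarrow> (real \<Rightarrow> 'x::real_normed_vector) set"
  where "Lp_functions p T = {u. strongly_measurable (lebesgue_on {0..T}) u \<and>
    integrable (lebesgue_on {0..T}) (\<lambda>s. norm (u s) powr p)}"

(* The integrand is Bochner integrable in 'y. The library's Bochner integral needs a second
   countable type; the Henstock-Kurzweil integral exists for every Bochner integrable function
   and has the same value. *)
definition p_admissible ::
    "real \<Rightarrow> real \<Rightarrow> ('x::complex_banach \<Rightarrow> 'y::complex_banach) \<Rightarrow> (real \<Rightarrow> 'y \<Rightarrow> 'y) \<Rightarrow>
      ('x \<Rightarrow> 'y) \<Rightarrow> bool"
  where "p_admissible p T j Sm1 B \<longleftrightarrow>
    (\<forall>u \<in> Lp_functions p T.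
      \<exists>x. ((\<lambda>s. Sm1 (T - s) (B (u s))) has_integral j x) {0..T})"

definition exponentially_stable :: "(real \<Rightarrow> 'x::real_normed_vector \<Rightarrow> 'x) \<Rightarrow> bool"
  where "exponentially_stable V \<longleftrightarrow>
    (\<exists>K>0. \<exists>\<sigma>>0. \<forall>x0. \<forall>t\<ge>0. norm (V t x0) \<le> K * exp (- \<sigma> * t) * norm x0)"

end

theory Submission
  imports Defs
begin

text \<open>
  The idea is an energy balance that is first order in \<open>\<rho>\<close> with errors of second order. Let \<open>V\<close> be the
  semigroup generated by the part of \<open>A - \<rho> B\<close> in X and write \<open>Q\<close> for the X-component of \<open>B\<close>. By
  dissipativity of the X-component of \<open>A\<close> (\<open>X_comp_dissipative\<close>), classical solutions satisfy
  \<open>norm (V T x)\<^sup>2 \<le> norm x\<^sup>2 - 2 \<rho> \<integral> Re \<langle>Q V t x, V t x\<rangle> dt\<close> (\<open>energy_estimate\<close>). The perturbed orbit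
  stays within \<open>O(\<rho>) norm x\<close> of the free orbit on \<open>[0, T]\<close> (\<open>V_minus_S\<close>), so the observability inequality,
  which concerns the free orbit, holds for the perturbed one up to \<open>O(\<rho>) norm x\<^sup>2\<close>. The gain \<open>\<rho> \<delta>\<close>
  beats the errors of order \<open>\<rho>\<^sup>2\<close> and \<open>V T\<close> is a strict contraction (\<open>stable_of_observability\<close>), which is
  exponential stability (\<open>exponentially_stableI\<close>).

  The remaining work is to construct \<open>V\<close> and to justify the \<open>O(\<rho>)\<close> estimate. Admissibility says that the
  input-to-state map \<open>\<Phi> t u = \<integral> Sm1 (t - s) (B (u s)) ds\<close> takes values in X at the time \<open>T\<close>. Tested on
  bounded continuous inputs, a closed graph argument (\<open>bounded_lift_through_injection\<close>) turns this into
  a norm bound. Constant inputs have explicit effects (\<open>orbit_integral_regular\<close>), since \<open>\<lambda> - A\<close> maps X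
  onto the extrapolation space; combined with delays of the input this
  transports the bound to all times up to \<open>T\<close>, and decomposition of time into blocks transports it to
  all times in a norm weighted by \<open>exp (- t)\<close> (\<open>ex_weighted_bound\<close>). For small \<open>\<rho>\<close> the mild equation
  \<open>x t = S t x0 - \<rho> \<Phi> t x\<close> is then a contractive fixed point equation on the half-line
  (\<open>mild_exists\<close>), its solutions form a \<open>C\<^sub>0\<close>-semigroup close to \<open>S\<close>, and differentiation in the
  extrapolation space identifies the generator (\<open>generator_V\<close>).
\<close>

section \<open>Scalars, integrals and density\<close>

lemma scaleR_conv_scaleC: "r *\<^sub>R (x::'a::complex_normed_vector) = complex_of_real r *\<^sub>C x"
  by (simp add: scaleC_of_real)

lemma scaleC_one [simp]: "1 *\<^sub>C (x::'a::complex_normed_vector) = x"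
  using scaleC_of_real[of 1 x] by simp

lemma scaleC_minus_one [simp]: "- 1 *\<^sub>C (x::'a::complex_normed_vector) = - x"
  using scaleC_of_real[of "- 1" x] by simp

lemma bounded_clinearD:
  assumes "bounded_clinear f"
  shows "bounded_linear f" "f (a *\<^sub>C x) = a *\<^sub>C f x"
  using assms by (auto simp: bounded_clinear_def)

lemma bounded_linear_scaleC: "bounded_linear (\<lambda>x::'a::complex_normed_vector. a *\<^sub>C x)"
proof (rule bounded_linear_intro)
  fix x y :: 'a and r :: real
  show "a *\<^sub>C (x + y) = a *\<^sub>C x + a *\<^sub>C y" by (rule scaleC_add_right)
  show "a *\<^sub>C (r *\<^sub>R x) = r *\<^sub>R (a *\<^sub>C x)"
    by (simp add: scaleR_conv_scaleC scaleC_scaleC mult.commute)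
  show "norm (a *\<^sub>C x) \<le> norm x * cmod a" by (simp add: norm_scaleC)
qed

lemma eventually_at_right_zeroI:
  assumes "\<And>h::real. 0 < h \<Longrightarrow> P h"
  shows "\<forall>\<^sub>F h in at_right 0. P h"
  using assms by (auto simp: eventually_at_filter)

lemma has_integral_reverse:
  fixes f :: "real \<Rightarrow> 'a::banach"
  assumes "(f has_integral I) {0..t}"
  shows "((\<lambda>s. f (t - s)) has_integral I) {0..t}"
proof -
  have "((\<lambda>x. f (x + t)) has_integral I) {- t..0}"
    using has_integral_shift_real_ivl[OF assms, of t] by simp
  then have "((\<lambda>x. f (- x + t)) has_integral I) {0..t}"
    by (subst has_integral_reflect_real[symmetric]) simp
  then show ?thesis by simp
qed

lemma integral_linear_image:
  fixes f :: "real \<Rightarrow> 'a::banach" and h :: "'a \<Rightarrow> 'b::banach"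
  assumes "continuous_on {a..b} f" "bounded_linear h"
  shows "h (integral {a..b} f) = integral {a..b} (\<lambda>s. h (f s))"
  using integral_linear[OF integrable_continuous_real[OF assms(1)] assms(2)]
  by (simp add: o_def)

text \<open>In the difference of the integrals over \<open>[h, t + h]\<close> and \<open>[0,
  t]\<close> the common part cancels, leaving two short integrals whose averages converge as
  \<open>h\<close> tends to 0.\<close>

lemma integral_diff_translate:
  fixes f :: "real \<Rightarrow> 'a::banach"
  assumes f: "continuous_on {0..} f" and "0 \<le> t" "0 \<le> h"
  shows "integral {0..t} (\<lambda>s. f (s + h)) - integral {0..t} f
       = integral {t..t + h} f - integral {0..h} f"
proof -
  have int: "f integrable_on {0..t + h}"
    by (intro integrable_continuous_real continuous_on_subset[OF f]) auto
  have "integral {0..t} (\<lambda>s. f (s + h)) = integral {h..t + h} f"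
    using integral_shift_real_ivl[of h h "t + h" f] by simp
  moreover have "integral {0..h} f + integral {h..t + h} f = integral {0..t + h} f"
    using Henstock_Kurzweil_Integration.integral_combine[where f = f and a = 0 and c = h and b = "t + h"] assms int by simp
  moreover have "integral {0..t} f + integral {t..t + h} f = integral {0..t + h} f"
    using Henstock_Kurzweil_Integration.integral_combine[where f = f and a = 0 and c = t and b = "t + h"] assms int by simp
  ultimately show ?thesis by (simp add: algebra_simps)
qed

text \<open>Derivatives of orbits arise as limits of difference quotients, on both sides of a
  point of the half-line at once; this form of the derivative lets one limit argument serve both
  sides.\<close>

lemma has_vector_derivative_iff_quotient:
  "(f has_vector_derivative D) (at t within s)
    \<longleftrightarrow> ((\<lambda>r. (f r - f t) /\<^sub>R (r - t)) \<longlongrightarrow> D) (at t within s)"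
proof -
  have "norm ((f y - f t - (y - t) *\<^sub>R D) /\<^sub>R norm (y - t)) = norm ((f y - f t) /\<^sub>R (y - t) - D)"
    if "y \<noteq> t" for y
  proof -
    have "(f y - f t) /\<^sub>R (y - t) - D = (f y - f t - (y - t) *\<^sub>R D) /\<^sub>R (y - t)"
      using that by (simp add: scaleR_diff_right)
    then show ?thesis by simp
  qed
  then have "\<forall>\<^sub>F y in at t within s. norm ((f y - f t - (y - t) *\<^sub>R D) /\<^sub>R norm (y - t))
      = norm ((f y - f t) /\<^sub>R (y - t) - D)"
    by (auto simp: eventually_at_filter)
  then have "((\<lambda>y. norm ((f y - f t - (y - t) *\<^sub>R D) /\<^sub>R norm (y - t))) \<longlongrightarrow> 0) (at t within s)
      \<longleftrightarrow> ((\<lambda>y. norm ((f y - f t) /\<^sub>R (y - t) - D)) \<longlongrightarrow> 0) (at t within s)"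
    by (rule tendsto_cong)
  then show ?thesis
    unfolding has_vector_derivative_def has_derivative_at_within tendsto_norm_zero_iff LIM_zero_iff
    by (simp add: bounded_linear_scaleR_left)
qed

lemma average_tendsto:
  fixes f :: "real \<Rightarrow> 'a::banach"
  assumes f: "continuous_on {0..} f" and t: "0 \<le> t"
  shows "((\<lambda>h. integral {t..t + h} f /\<^sub>R h) \<longlongrightarrow> f t) (at_right 0)"
proof -
  have "((\<lambda>u. integral {t..u} f) has_vector_derivative f t) (at t within {t..t + 1})"
    using t by (intro integral_has_vector_derivative continuous_on_subset[OF f]) auto
  then have "((\<lambda>u. (integral {t..u} f - integral {t..t} f) /\<^sub>R (u - t)) \<longlongrightarrow> f t) (at t within {t..t + 1})"
    unfolding has_vector_derivative_iff_quotient .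
  then have "((\<lambda>u. integral {t..u} f /\<^sub>R (u - t)) \<longlongrightarrow> f t) (at_right t)"
    by (simp add: at_within_Icc_at_right)
  then show ?thesis
    unfolding filterlim_at_right_to_0[of _ _ t] by (simp add: add.commute)
qed

lemma le_mult_exp:
  fixes K s :: real
  assumes "0 \<le> K" "0 \<le> s"
  shows "K \<le> K * exp s"
  using mult_left_mono[of 1 "exp s" K] assms by auto

lemma continuous_on_halflineI:
  fixes f :: "real \<Rightarrow> 'a::topological_space"
  assumes "\<And>N. continuous_on {0..N} f"
  shows "continuous_on {0..} f"
  unfolding continuous_on_eq_continuous_within
proof
  fix t :: real assume t: "t \<in> {0..}"
  have "continuous (at t within {0..t + 1}) f"
    using assms[of "t + 1"] t by (auto simp: continuous_on_eq_continuous_within)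
  moreover have "at t within {0..t + 1} = at t within {0..}"
    by (rule at_within_nhd[of _ "{..<t + 1}"]) auto
  ultimately show "continuous (at t within {0..}) f" by (simp add: continuous_within)
qed

lemma integral_has_vector_derivative_halfline:
  fixes f :: "real \<Rightarrow> 'a::banach"
  assumes f: "continuous_on {0..} f" and t: "0 \<le> t"
  shows "((\<lambda>u. integral {0..u} f) has_vector_derivative f t) (at t within {0..})"
proof -
  have "((\<lambda>u. integral {0..u} f) has_vector_derivative f t) (at t within {0..t + 1})"
    using t by (intro integral_has_vector_derivative continuous_on_subset[OF f]) auto
  moreover have "at t within {0..t + 1} = at t within {0..}"
    by (rule at_within_nhd[of _ "{..<t + 1}"]) auto
  ultimately show ?thesis by simp
qed

text \<open>A closed property passes from the embedded space to its completion; together with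
  \<open>dense_domain_induct\<close> this is how relations below are extended by
  density.\<close>

lemma dense_range_induct:
  assumes "closure (range j) = UNIV" "closed {y. P y}" "\<And>x. P (j x)"
  shows "P y"
proof -
  have "closure (range j) \<subseteq> {y. P y}"
    using assms(2,3) by (intro closure_minimal) auto
  then show ?thesis using assms(1) by auto
qed

lemma dense_domain_induct:
  assumes "closure (Domain G) = UNIV" "closed {x. P x}" "\<And>x y. (x, y) \<in> G \<Longrightarrow> P x"
  shows "P x"
proof -
  have "closure (Domain G) \<subseteq> {x. P x}"
    using assms(2,3) by (intro closure_minimal) auto
  then show ?thesis using assms(1) by auto
qed

section \<open>Semigroups and their generators\<close>

text \<open>Every \<open>C\<^sub>0\<close>-semigroup satisfies a bound \<open>C exp (\<omega>
  t)\<close>. The rate \<open>\<omega> = 1\<close> is fixed because it covers both contraction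
  semigroups (with \<open>C = 1\<close>) and the perturbed semigroup, whose bound comes from a
  fixed point argument in the space weighted by \<open>exp t\<close>.\<close>

locale growth_semigroup =
  fixes S :: "real \<Rightarrow> 'x::complex_banach \<Rightarrow> 'x" and C :: real
  assumes C0: "C0_semigroup S"
    and C_nonneg: "0 \<le> C"
    and growth: "\<And>t x. 0 \<le> t \<Longrightarrow> norm (S t x) \<le> C * exp t * norm x"
begin

lemma semigroup_clinear: "0 \<le> t \<Longrightarrow> bounded_clinear (S t)"
  using C0 by (simp add: C0_semigroup_def)

lemma semigroup_linear: "0 \<le> t \<Longrightarrow> bounded_linear (S t)"
  by (rule bounded_clinearD(1)[OF semigroup_clinear])

lemma semigroup_zero [simp]: "S 0 x = x"
  using C0 by (simp add: C0_semigroup_def)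

lemma semigroup_add: "0 \<le> s \<Longrightarrow> 0 \<le> t \<Longrightarrow> S (s + t) x = S s (S t x)"
  using C0 by (simp add: C0_semigroup_def)

lemma semigroup_diff: "0 \<le> t \<Longrightarrow> S t (x - y) = S t x - S t y"
  by (rule linear_diff[OF bounded_linear.linear[OF semigroup_linear]])

text \<open>Increments of an orbit at any time reduce to increments at time 0; writing the
  earlier of the two times in front avoids a separate treatment of left and right
  limits.\<close>

lemma orbit_diff:
  assumes "0 \<le> s" "0 \<le> t"
  shows "S t x - S s x = (if s \<le> t then S s (S \<bar>t - s\<bar> x - x) else - S t (S \<bar>t - s\<bar> x - x))"
  using semigroup_add[of s "t - s" x] semigroup_add[of t "s - t" x] assms by (auto simp: semigroup_diff)

lemma norm_orbit_diff:
  assumes "0 \<le> s" "0 \<le> t"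
  shows "norm (S t x - S s x) \<le> C * exp s * norm (S \<bar>t - s\<bar> x - x)"
proof -
  have "norm (S t x - S s x) \<le> C * exp (min s t) * norm (S \<bar>t - s\<bar> x - x)"
    unfolding orbit_diff[OF assms]
    using growth[of s "S \<bar>t - s\<bar> x - x"] growth[of t "S \<bar>t - s\<bar> x - x"] assms
    by (auto simp: min_def)
  also have "\<dots> \<le> C * exp s * norm (S \<bar>t - s\<bar> x - x)"
    by (intro mult_right_mono mult_left_mono C_nonneg) auto
  finally show ?thesis .
qed

lemma isCont_orbit_abs: "isCont (\<lambda>h. S \<bar>h\<bar> x) 0"
proof -
  have r: "((\<lambda>h. S h x) \<longlongrightarrow> x) (at_right 0)"
    using C0 by (simp add: C0_semigroup_def)
  have "((\<lambda>h. S \<bar>h\<bar> x) \<longlongrightarrow> x) (at_right 0)"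
    using r by (rule Lim_transform_eventually) (auto simp: eventually_at_filter)
  moreover have "((\<lambda>h. S \<bar>h\<bar> x) \<longlongrightarrow> x) (at_left 0)"
    unfolding filterlim_at_left_to_right using calculation by simp
  ultimately show ?thesis
    by (simp add: isCont_def filterlim_split_at)
qed

text \<open>Strong continuity together with the local uniform bound gives joint continuity in
  time and state. All derivative computations below rest on this.\<close>

lemma tendsto_joint:
  assumes f: "(f \<longlongrightarrow> y) F" and g: "(g \<longlongrightarrow> a) F" and a: "0 \<le> a"
    and pos: "\<forall>\<^sub>F x in F. 0 \<le> g x"
  shows "((\<lambda>x. S (g x) (f x)) \<longlongrightarrow> S a y) F"
proof -
  have "((\<lambda>x. \<bar>g x - a\<bar>) \<longlongrightarrow> 0) F"
    using g by (simp add: tendsto_rabs_zero_iff LIM_zero_iff)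
  then have "((\<lambda>x. S \<bar>\<bar>g x - a\<bar>\<bar> y) \<longlongrightarrow> S \<bar>0\<bar> y) F"
    by (rule isCont_tendsto_compose[OF isCont_orbit_abs])
  then have 1: "((\<lambda>x. C * exp (g x) * norm (f x - y) + C * exp a * norm (S \<bar>g x - a\<bar> y - y)) \<longlongrightarrow> 0) F"
    by (auto intro!: tendsto_eq_intros f g)
  have bound: "norm (S (g x) (f x) - S a y)
      \<le> C * exp (g x) * norm (f x - y) + C * exp a * norm (S \<bar>g x - a\<bar> y - y)" (is "_ \<le> ?r x")
    if "0 \<le> g x" for x
  proof -
    have "norm (S (g x) (f x) - S a y) = norm (S (g x) (f x - y) + (S (g x) y - S a y))"
      using that by (simp add: semigroup_diff)
    also have "\<dots> \<le> norm (S (g x) (f x - y)) + norm (S (g x) y - S a y)"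
      by (rule norm_triangle_ineq)
    also have "\<dots> \<le> ?r x"
      by (rule add_mono[OF growth[OF that] norm_orbit_diff[OF a that]])
    finally show ?thesis .
  qed
  have "\<forall>\<^sub>F x in F. norm (S (g x) (f x) - S a y) \<le> ?r x"
    by (rule eventually_mono[OF pos bound])
  then have "((\<lambda>x. S (g x) (f x) - S a y) \<longlongrightarrow> 0) F"
    by (rule Lim_null_comparison[OF _ 1])
  then show ?thesis by (rule LIM_zero_cancel)
qed

lemma continuous_joint:
  assumes "continuous_on D f" "continuous_on D g" "\<And>x. x \<in> D \<Longrightarrow> 0 \<le> g x"
  shows "continuous_on D (\<lambda>x. S (g x) (f x))"
  using assms unfolding continuous_on_def
  by (auto intro!: tendsto_joint simp: eventually_at_filter)

lemma continuous_orbit: "D \<subseteq> {0..} \<Longrightarrow> continuous_on D (\<lambda>t. S t x)"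
  by (rule continuous_joint) (auto intro: continuous_intros)

lemma generator_invariant:
  assumes "(x, y) \<in> generator S" "0 \<le> t"
  shows "(S t x, S t y) \<in> generator S"
proof -
  have "((\<lambda>h. S t ((S h x - x) /\<^sub>R h)) \<longlongrightarrow> S t y) (at_right 0)"
    using assms by (intro bounded_linear.tendsto[OF semigroup_linear]) (simp_all add: generator_def)
  then have "((\<lambda>h. (S h (S t x) - S t x) /\<^sub>R h) \<longlongrightarrow> S t y) (at_right 0)"
  proof (rule Lim_transform_eventually)
    have "S t ((S h x - x) /\<^sub>R h) = (S h (S t x) - S t x) /\<^sub>R h" if "0 < h" for h
      using semigroup_add[of t h x] semigroup_add[of h t x] that assms(2) by (simp add: linear_scale[OF bounded_linear.linear[OF semigroup_linear]] semigroup_diff add.commute)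
    then show "\<forall>\<^sub>F h in at_right 0. S t ((S h x - x) /\<^sub>R h) = (S h (S t x) - S t x) /\<^sub>R h"
      by (auto simp: eventually_at_filter)
  qed
  then show ?thesis by (simp add: generator_def)
qed

lemma orbit_derivative:
  assumes gen: "(x, y) \<in> generator S" and t: "0 \<le> t"
  shows "((\<lambda>t. S t x) has_vector_derivative S t y) (at t within {0..})"
proof -
  have r: "((\<lambda>h. (S h x - x) /\<^sub>R h) \<longlongrightarrow> y) (at_right 0)"
    using gen by (simp add: generator_def)
  have lim: "filterlim (\<lambda>r. \<bar>r - t\<bar>) (at_right 0) (at t within {0..})"
    unfolding filterlim_at
    by (auto intro!: tendsto_eq_intros simp: eventually_at_filter)
  have "((\<lambda>r. S (min r t) ((S \<bar>r - t\<bar> x - x) /\<^sub>R \<bar>r - t\<bar>)) \<longlongrightarrow> S t y) (at t within {0..})"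
    using t by (intro tendsto_joint filterlim_compose[OF r lim])
      (auto intro!: tendsto_eq_intros simp: eventually_at_filter)
  moreover have "\<forall>\<^sub>F r in at t within {0..}. S (min r t) ((S \<bar>r - t\<bar> x - x) /\<^sub>R \<bar>r - t\<bar>)
      = (S r x - S t x) /\<^sub>R (r - t)"
  proof -
    have "S (min r t) ((S \<bar>r - t\<bar> x - x) /\<^sub>R \<bar>r - t\<bar>) = (S r x - S t x) /\<^sub>R (r - t)"
      if "0 \<le> r" "r \<noteq> t" for r
    proof (cases "t \<le> r")
      case True
      then show ?thesis
        using that(2) orbit_diff[OF t that(1), of x]
          linear_scale[OF bounded_linear.linear[OF semigroup_linear[OF t]]]
        by (simp add: min_def)
    next
      case False
      then show ?thesis
        using orbit_diff[OF t that(1), of x]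
          linear_scale[OF bounded_linear.linear[OF semigroup_linear[OF that(1)]]]
        by (simp add: min_def) (simp add: divide_simps flip: scaleR_minus_left)
    qed
    then show ?thesis by (auto simp: eventually_at_filter)
  qed
  ultimately have "((\<lambda>r. (S r x - S t x) /\<^sub>R (r - t)) \<longlongrightarrow> S t y) (at t within {0..})"
    by (rule Lim_transform_eventually)
  then show ?thesis
    unfolding has_vector_derivative_iff_quotient .
qed

lemma orbit_integral:
  assumes "(x, y) \<in> generator S" "0 \<le> t"
  shows "S t x - x = integral {0..t} (\<lambda>s. S s y)"
  using fundamental_theorem_of_calculus[OF assms(2), of "\<lambda>t. S t x" "\<lambda>t. S t y"]
    has_vector_derivative_within_subset[OF orbit_derivative[OF assms(1)], of _ "{0..t}"]
  by (auto simp: integral_unique)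

lemma integral_in_generator:
  assumes t: "0 \<le> t"
  shows "(integral {0..t} (\<lambda>s. S s x), S t x - x) \<in> generator S"
proof -
  have c: "continuous_on {0..} (\<lambda>s. S s x)" by (rule continuous_orbit) simp
  have "((\<lambda>h. integral {t..t + h} (\<lambda>s. S s x) /\<^sub>R h - integral {0..0 + h} (\<lambda>s. S s x) /\<^sub>R h)
      \<longlongrightarrow> S t x - S 0 x) (at_right 0)"
    using t by (intro tendsto_diff average_tendsto c) auto
  moreover have "integral {t..t + h} (\<lambda>s. S s x) /\<^sub>R h - integral {0..0 + h} (\<lambda>s. S s x) /\<^sub>R h
      = (S h (integral {0..t} (\<lambda>s. S s x)) - integral {0..t} (\<lambda>s. S s x)) /\<^sub>R h"
    if h: "0 < h" for h
  proof -
    have "S h (integral {0..t} (\<lambda>s. S s x)) = integral {0..t} (\<lambda>s. S h (S s x))"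
      using h t by (intro integral_linear_image semigroup_linear continuous_orbit) auto
    also have "\<dots> = integral {0..t} (\<lambda>s. S (s + h) x)"
      using h by (intro integral_cong) (metis semigroup_add add.commute atLeastAtMost_iff less_eq_real_def)
    finally show ?thesis
      using integral_diff_translate[OF c t, of h] h by (simp flip: scaleR_diff_right)
  qed
  then have "\<forall>\<^sub>F h in at_right 0.
      integral {t..t + h} (\<lambda>s. S s x) /\<^sub>R h - integral {0..0 + h} (\<lambda>s. S s x) /\<^sub>R h
      = (S h (integral {0..t} (\<lambda>s. S s x)) - integral {0..t} (\<lambda>s. S s x)) /\<^sub>R h"
    by (auto simp: eventually_at_filter)
  ultimately show ?thesis
    unfolding generator_def by (auto elim: Lim_transform_eventually)
qed

lemma generator_add_scale:
  assumes "(x, y) \<in> generator S" "(x', y') \<in> generator S"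
  shows "(x + a *\<^sub>C x', y + a *\<^sub>C y') \<in> generator S"
proof -
  have "((\<lambda>h. (S h x - x) /\<^sub>R h + a *\<^sub>C ((S h x' - x') /\<^sub>R h)) \<longlongrightarrow> y + a *\<^sub>C y') (at_right 0)"
    using assms
    by (auto simp: generator_def intro!: tendsto_add bounded_linear.tendsto[OF bounded_linear_scaleC])
  moreover have "(S h x - x) /\<^sub>R h + a *\<^sub>C ((S h x' - x') /\<^sub>R h)
      = (S h (x + a *\<^sub>C x') - (x + a *\<^sub>C x')) /\<^sub>R h" if "0 < h" for h
    using that linear_add[OF bounded_linear.linear[OF semigroup_linear]] bounded_clinearD(2)[OF semigroup_clinear]
    by (simp add: linear_scale[OF bounded_linear.linear[OF bounded_linear_scaleC]]
        linear_diff[OF bounded_linear.linear[OF bounded_linear_scaleC]] algebra_simps)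
  then have "\<forall>\<^sub>F h in at_right 0. (S h x - x) /\<^sub>R h + a *\<^sub>C ((S h x' - x') /\<^sub>R h)
      = (S h (x + a *\<^sub>C x') - (x + a *\<^sub>C x')) /\<^sub>R h"
    by (auto simp: eventually_at_filter)
  ultimately show ?thesis
    unfolding generator_def by (auto elim: Lim_transform_eventually)
qed

lemma domain_dense: "closure (Domain (generator S)) = UNIV"
proof -
  have "x \<in> closure (Domain (generator S))" for x
  proof (rule Lim_in_closed_set[OF closed_closure _ _ average_tendsto[OF continuous_orbit, of 0, simplified]])
    show "\<forall>\<^sub>F h in at_right 0. integral {0..h} (\<lambda>s. S s x) /\<^sub>R h \<in> closure (Domain (generator S))"
    proof -
      have "integral {0..h} (\<lambda>s. S s x) /\<^sub>R h \<in> Domain (generator S)" if "0 < h" for h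
      proof -
        have "(0 + complex_of_real (inverse h) *\<^sub>C integral {0..h} (\<lambda>s. S s x),
            0 + complex_of_real (inverse h) *\<^sub>C (S h x - x)) \<in> generator S"
          using generator_add_scale[OF integral_in_generator[of 0 x] integral_in_generator[of h x],
              of "complex_of_real (inverse h)"] that
          by simp
        then show ?thesis
          unfolding scaleC_of_real by (auto intro: DomainI)
      qed
      then show ?thesis
        by (intro eventually_at_right_zeroI subsetD[OF closure_subset])
    qed
  qed auto
  then show ?thesis by auto
qed

end

lemma growth_semigroup_contraction:
  fixes S :: "real \<Rightarrow> 'x::complex_banach \<Rightarrow> 'x"
  assumes "contraction_semigroup S"
  shows "growth_semigroup S 1"
proof
  show "C0_semigroup S" using assms by (simp add: contraction_semigroup_def)
  show "(0::real) \<le> 1" by simp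
  fix t :: real and x :: 'x
  assume "0 \<le> t"
  then have "norm (S t x) \<le> norm x" "1 * norm x \<le> exp t * norm x"
    using assms mult_right_mono[of 1 "exp t" "norm x"] by (auto simp: contraction_semigroup_def)
  then show "norm (S t x) \<le> 1 * exp t * norm x" by simp
qed

lemma (in growth_semigroup) norm_orbit_integral:
  assumes "0 \<le> t"
  shows "norm (integral {0..t} (\<lambda>s. S s y)) \<le> C * exp t * norm y * t"
proof -
  have "norm (S s y) \<le> C * exp t * norm y" if "s \<in> {0..t}" for s
  proof -
    have "norm (S s y) \<le> C * exp s * norm y" using that by (intro growth) auto
    also have "\<dots> \<le> C * exp t * norm y"
      using that by (intro mult_right_mono mult_left_mono C_nonneg) auto
    finally show ?thesis .
  qed
  then show ?thesis
    using integral_bound[OF assms continuous_orbit[of "{0..t}" y]] by auto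
qed

lemma (in growth_semigroup) bounded_linear_orbit_integral:
  assumes t: "0 \<le> t"
  shows "bounded_linear (\<lambda>y. integral {0..t} (\<lambda>s. S s y))"
proof (rule bounded_linear_intro)
  fix x y r
  have i: "(\<lambda>s. S s z) integrable_on {0..t}" for z
    by (intro integrable_continuous_real continuous_orbit) auto
  have "integral {0..t} (\<lambda>s. S s (x + y)) = integral {0..t} (\<lambda>s. S s x + S s y)"
    by (intro integral_cong linear_add[OF bounded_linear.linear[OF semigroup_linear]]) auto
  then show "integral {0..t} (\<lambda>s. S s (x + y)) = integral {0..t} (\<lambda>s. S s x) + integral {0..t} (\<lambda>s. S s y)"
    by (simp add: integral_add i)
  have "integral {0..t} (\<lambda>s. S s (r *\<^sub>R x)) = integral {0..t} (\<lambda>s. r *\<^sub>R S s x)"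
    by (intro integral_cong linear_scale[OF bounded_linear.linear[OF semigroup_linear]]) auto
  then show "integral {0..t} (\<lambda>s. S s (r *\<^sub>R x)) = r *\<^sub>R integral {0..t} (\<lambda>s. S s x)"
    by simp
  show "norm (integral {0..t} (\<lambda>s. S s x)) \<le> norm x * (C * exp t * t)"
    using norm_orbit_integral[OF t, of x] by (simp add: mult_ac)
qed

text \<open>Product rule for \<open>S r (f r)\<close>: the increment splits into \<open>S
  r\<close> applied to the increment of \<open>f\<close>, handled by joint continuity, and the
  increment of an orbit starting in the domain of the generator.\<close>

lemma (in growth_semigroup) product_derivative:
  assumes gen: "(f s, g) \<in> generator S" and s: "0 \<le> s" and D: "D \<subseteq> {0..}"
    and f: "(f has_vector_derivative f') (at s within D)"
  shows "((\<lambda>r. S r (f r)) has_vector_derivative S s (g + f')) (at s within D)"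
proof -
  have "((\<lambda>r. S r ((f r - f s) /\<^sub>R (r - s))) \<longlongrightarrow> S s f') (at s within D)"
  proof (rule tendsto_joint)
    show "\<forall>\<^sub>F r in at s within D. 0 \<le> r"
      using D by (intro eventually_at_filter[THEN iffD2] always_eventually) auto
  qed (use f s in \<open>simp_all add: has_vector_derivative_iff_quotient\<close>)
  moreover have "((\<lambda>r. (S r (f s) - S s (f s)) /\<^sub>R (r - s)) \<longlongrightarrow> S s g) (at s within D)"
    using has_vector_derivative_within_subset[OF orbit_derivative[OF gen s] D]
    by (simp add: has_vector_derivative_iff_quotient)
  ultimately have "((\<lambda>r. (S r (f s) - S s (f s)) /\<^sub>R (r - s) + S r ((f r - f s) /\<^sub>R (r - s)))
      \<longlongrightarrow> S s g + S s f') (at s within D)"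
    by (rule tendsto_add[rotated])
  moreover have "\<forall>\<^sub>F r in at s within D. (S r (f s) - S s (f s)) /\<^sub>R (r - s) + S r ((f r - f s) /\<^sub>R (r - s))
      = (S r (f r) - S s (f s)) /\<^sub>R (r - s)"
  proof -
    have "(S r (f s) - S s (f s)) /\<^sub>R (r - s) + S r ((f r - f s) /\<^sub>R (r - s))
      = (S r (f r) - S s (f s)) /\<^sub>R (r - s)" if "r \<in> D" for r
    proof -
      have r: "0 \<le> r" using that D by auto
      have "S r ((f r - f s) /\<^sub>R (r - s)) = (S r (f r) - S r (f s)) /\<^sub>R (r - s)"
        by (simp add: linear_scale[OF bounded_linear.linear[OF semigroup_linear[OF r]]] semigroup_diff[OF r])
      then show ?thesis by (simp flip: scaleR_add_right)
    qed
    then show ?thesis by (auto simp: eventually_at_filter)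
  qed
  ultimately have "((\<lambda>r. (S r (f r) - S s (f s)) /\<^sub>R (r - s)) \<longlongrightarrow> S s g + S s f') (at s within D)"
    by (rule Lim_transform_eventually)
  then show ?thesis
    by (simp add: has_vector_derivative_iff_quotient linear_add[OF bounded_linear.linear[OF semigroup_linear[OF s]]])
qed

section \<open>The extrapolation space\<close>

locale extrapolated_semigroup =
  fixes S :: "real \<Rightarrow> 'x::complex_banach \<Rightarrow> 'x"
    and lam :: complex
    and j :: "'x \<Rightarrow> 'y::complex_banach"
    and Am1 :: "'x \<Rightarrow> 'y"
    and Sm1 :: "real \<Rightarrow> 'y \<Rightarrow> 'y"
  assumes contraction: "contraction_semigroup S"
    and space: "extrapolation_space (generator S) lam j"
    and operator: "operator_extension j (generator S) Am1"
    and extension: "semigroup_extension j S Sm1"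
begin

sublocale X: growth_semigroup S 1
  by (rule growth_semigroup_contraction[OF contraction])

lemma contr: "0 \<le> t \<Longrightarrow> norm (S t x) \<le> norm x"
  using contraction by (simp add: contraction_semigroup_def)

abbreviation "R \<equiv> resolvent (generator S) lam"

lemma resolvent: "is_resolvent (generator S) lam R"
proof -
  obtain Q where Q: "is_resolvent (generator S) lam Q"
    using space by (auto simp: extrapolation_space_def resolvent_set_def)
  have "Q' = Q" if "is_resolvent (generator S) lam Q'" for Q'
    using that Q unfolding is_resolvent_def by (intro ext) metis
  with Q show ?thesis
    unfolding resolvent_def by (rule theI)
qed

lemma resolvent_iff: "R z = x \<longleftrightarrow> (\<exists>y. (x, y) \<in> generator S \<and> lam *\<^sub>C x - y = z)"
  using resolvent by (simp add: is_resolvent_def)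

lemma j_clinear: "bounded_clinear j" and norm_j: "norm (j x) = norm (R x)"
  and j_dense: "closure (range j) = UNIV"
  using space by (auto simp: extrapolation_space_def)

lemma Am1_clinear: "bounded_clinear Am1" and Am1_generator: "(x, y) \<in> generator S \<Longrightarrow> Am1 x = j y"
  using operator by (auto simp: operator_extension_def)

lemma Sm1_clinear: "0 \<le> t \<Longrightarrow> bounded_clinear (Sm1 t)" and Sm1_j: "0 \<le> t \<Longrightarrow> Sm1 t (j x) = j (S t x)"
  using extension by (auto simp: semigroup_extension_def)

lemmas j_linear = bounded_clinearD(1)[OF j_clinear]
lemmas Am1_linear = bounded_clinearD(1)[OF Am1_clinear]
lemmas Sm1_linear = bounded_clinearD(1)[OF Sm1_clinear]

text \<open>The norm of \<open>j x\<close> is that of \<open>R x\<close>, and a resolvent is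
  injective because a generator is single-valued at 0.\<close>

lemma inj_j: "j x = j y \<longleftrightarrow> x = y"
proof
  assume "j x = j y"
  then have "norm (j (x - y)) = 0"
    by (simp add: linear_diff[OF bounded_linear.linear[OF j_linear]])
  then have "R (x - y) = 0" by (simp add: norm_j)
  then obtain z where z: "(0, z) \<in> generator S" "lam *\<^sub>C 0 - z = x - y"
    unfolding resolvent_iff by blast
  have 0: "S h 0 = 0" if "0 \<le> h" for h
    using linear_0[OF bounded_linear.linear[OF X.semigroup_linear[OF that]]] .
  have "((\<lambda>h. (S h 0 - 0) /\<^sub>R h) \<longlongrightarrow> z) (at_right 0)"
    using z by (simp add: generator_def)
  then have "((\<lambda>h. 0) \<longlongrightarrow> z) (at_right (0::real))"
    by (rule Lim_transform_eventually) (auto simp: eventually_at_filter 0)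
  then have "z = 0" by (simp add: tendsto_const_iff)
  moreover have "lam *\<^sub>C (0::'x) = 0"
    using linear_0[OF bounded_linear.linear[OF bounded_linear_scaleC]] .
  ultimately show "x = y" using z by simp
qed simp

text \<open>The semigroup preserves the generator, so it commutes with the resolvent. Hence the
  contraction property of \<open>S\<close> survives in the extrapolation norm.\<close>

lemma resolvent_commute:
  assumes "0 \<le> t"
  shows "R (S t x) = S t (R x)"
proof -
  obtain y where y: "(R x, y) \<in> generator S" "lam *\<^sub>C R x - y = x"
    using resolvent_iff by blast
  have "S t x = S t (lam *\<^sub>C R x) - S t y"
    using y(2) X.semigroup_diff[OF assms] by metis
  then have "lam *\<^sub>C S t (R x) - S t y = S t x"
    by (simp add: bounded_clinearD(2)[OF X.semigroup_clinear[OF assms]])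
  then show ?thesis
    using X.generator_invariant[OF y(1) assms] resolvent_iff by blast
qed

lemma Sm1_contr:
  assumes t: "0 \<le> t"
  shows "norm (Sm1 t y) \<le> norm y"
proof (rule dense_range_induct[OF j_dense])
  show "closed {y. norm (Sm1 t y) \<le> norm y}"
    by (intro closed_Collect_le continuous_intros bounded_linear.continuous_on[OF Sm1_linear[OF t]])
  show "norm (Sm1 t (j x)) \<le> norm (j x)" for x
    using contr[OF t, of "R x"] by (simp add: Sm1_j[OF t] norm_j resolvent_commute[OF t])
qed

lemma Sm1_contraction: "contraction_semigroup Sm1"
proof -
  have "Sm1 0 = id"
  proof (rule ext)
    fix y show "Sm1 0 y = id y"
    proof (rule dense_range_induct[OF j_dense, where P = "\<lambda>y. Sm1 0 y = id y"])
      show "closed {y. Sm1 0 y = id y}" unfolding id_def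
        by (intro closed_Collect_eq continuous_intros bounded_linear.continuous_on[OF Sm1_linear]) auto
    qed (simp add: Sm1_j)
  qed
  moreover have "Sm1 (s + t) = Sm1 s \<circ> Sm1 t" if st: "0 \<le> s" "0 \<le> t" for s t
  proof (rule ext)
    fix y show "Sm1 (s + t) y = (Sm1 s \<circ> Sm1 t) y"
    proof (rule dense_range_induct[OF j_dense, where P = "\<lambda>y. Sm1 (s + t) y = (Sm1 s \<circ> Sm1 t) y"])
      show "closed {y. Sm1 (s + t) y = (Sm1 s \<circ> Sm1 t) y}" unfolding o_def
        using st
        by (intro closed_Collect_eq continuous_intros bounded_linear.continuous_on[OF Sm1_linear]) auto
    qed (use st in \<open>simp add: Sm1_j X.semigroup_add\<close>)
  qed
  moreover have "((\<lambda>t. Sm1 t y) \<longlongrightarrow> y) (at_right 0)" for y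
  proof (rule tendstoI)
    fix e :: real assume e: "0 < e"
    obtain x where x: "dist (j x) y < e / 3"
      using closure_approachable[THEN iffD1, rule_format, of y "range j" "e / 3"] j_dense e by auto
    have "((\<lambda>t. j (S t x)) \<longlongrightarrow> j x) (at_right 0)"
      using X.C0 by (intro bounded_linear.tendsto[OF j_linear]) (simp add: C0_semigroup_def)
    then have "\<forall>\<^sub>F t in at_right 0. dist (j (S t x)) (j x) < e / 3"
      using e by (intro tendstoD) auto
    moreover have "\<forall>\<^sub>F t in at_right (0::real). 0 < t"
      by (simp add: eventually_at_filter)
    ultimately show "\<forall>\<^sub>F t in at_right 0. dist (Sm1 t y) y < e"
    proof eventually_elim
      case (elim t)
      have "norm (Sm1 t (y - j x)) \<le> norm (y - j x)"
        using elim by (intro Sm1_contr) auto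
      then have "dist (Sm1 t y) (j (S t x)) < e / 3"
        using x elim by (simp add: dist_norm norm_minus_commute Sm1_j
            linear_diff[OF bounded_linear.linear[OF Sm1_linear]])
      then show ?case
        using x elim dist_triangle[of "Sm1 t y" y "j (S t x)"] dist_triangle[of "j (S t x)" y "j x"]
        by linarith
    qed
  qed
  ultimately show ?thesis
    by (simp add: contraction_semigroup_def C0_semigroup_def Sm1_clinear Sm1_contr)
qed

sublocale Y: growth_semigroup Sm1 1
  by (rule growth_semigroup_contraction[OF Sm1_contraction])

text \<open>Both sides are bounded in \<open>x\<close> as maps from X to the extrapolation space
  and agree on the domain of the generator, so they agree on X. This identifies
  \<open>Am1\<close> on all of X as the generator of \<open>Sm1\<close> without any smoothness
  of \<open>x\<close>.\<close>

lemma Sm1_increment: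
  assumes t: "0 \<le> t"
  shows "Sm1 t (j x) - j x = integral {0..t} (\<lambda>s. Sm1 s (Am1 x))"
proof (rule dense_domain_induct[OF X.domain_dense])
  show "closed {x. Sm1 t (j x) - j x = integral {0..t} (\<lambda>s. Sm1 s (Am1 x))}"
    by (intro closed_Collect_eq linear_continuous_on bounded_linear_sub j_linear
        bounded_linear_compose[OF Sm1_linear[OF t] j_linear]
        bounded_linear_compose[OF Y.bounded_linear_orbit_integral[OF t] Am1_linear])
  fix x y assume xy: "(x, y) \<in> generator S"
  have "Sm1 t (j x) - j x = j (S t x - x)"
    using t by (simp add: Sm1_j linear_diff[OF bounded_linear.linear[OF j_linear]])
  also have "\<dots> = j (integral {0..t} (\<lambda>s. S s y))"
    using X.orbit_integral[OF xy t] by simp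
  also have "\<dots> = integral {0..t} (\<lambda>s. j (S s y))"
    by (intro integral_linear_image X.continuous_orbit j_linear) auto
  also have "\<dots> = integral {0..t} (\<lambda>s. Sm1 s (Am1 x))"
    by (intro integral_cong) (simp add: Sm1_j Am1_generator[OF xy])
  finally show "Sm1 t (j x) - j x = integral {0..t} (\<lambda>s. Sm1 s (Am1 x))" .
qed

lemma extrapolated_generator: "(j x, Am1 x) \<in> generator Sm1"
proof -
  have "((\<lambda>h. integral {0..0 + h} (\<lambda>s. Sm1 s (Am1 x)) /\<^sub>R h) \<longlongrightarrow> Sm1 0 (Am1 x)) (at_right 0)"
    by (intro average_tendsto Y.continuous_orbit) auto
  then have "((\<lambda>h. integral {0..h} (\<lambda>s. Sm1 s (Am1 x)) /\<^sub>R h) \<longlongrightarrow> Am1 x) (at_right 0)" by simp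
  then have "((\<lambda>h. (Sm1 h (j x) - j x) /\<^sub>R h) \<longlongrightarrow> Am1 x) (at_right 0)"
    by (rule Lim_transform_eventually) (simp add: Sm1_increment eventually_at_right_zeroI)
  then show ?thesis by (simp add: generator_def)
qed

lemma shifted_linear: "bounded_linear (\<lambda>x. lam *\<^sub>C j x - Am1 x)"
  by (intro bounded_linear_sub Am1_linear bounded_linear_compose[OF bounded_linear_scaleC j_linear])

text \<open>With the resolvent norm on the extrapolation space, \<open>\<lambda> - A\<close> is
  an isometry: on the domain of the generator the norm of its value is \<open>norm (R (\<lambda>
  x - A x)) = norm x\<close>. Being onto as well (\<open>shifted_surj\<close>), it parametrises
  the extrapolation space by X.\<close>

lemma shifted_isometry: "norm (lam *\<^sub>C j x - Am1 x) = norm x"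
proof (rule dense_domain_induct[OF X.domain_dense])
  show "closed {x. norm (lam *\<^sub>C j x - Am1 x) = norm x}"
    by (intro closed_Collect_eq continuous_on_norm linear_continuous_on[OF shifted_linear] continuous_on_id)
  fix x y assume xy: "(x, y) \<in> generator S"
  have "lam *\<^sub>C j x - Am1 x = j (lam *\<^sub>C x - y)"
    by (simp add: Am1_generator[OF xy] bounded_clinearD(2)[OF j_clinear] linear_diff[OF bounded_linear.linear[OF j_linear]])
  moreover have "R (lam *\<^sub>C x - y) = x"
    using xy resolvent_iff by blast
  ultimately show "norm (lam *\<^sub>C j x - Am1 x) = norm x" by (simp add: norm_j)
qed

text \<open>An isometry on a complete space has closed range, and this range contains the dense
  subspace \<open>range j\<close> since \<open>\<lambda> - A\<close> maps the domain onto
  X.\<close>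

lemma shifted_surj: "\<exists>x. lam *\<^sub>C j x - Am1 x = y"
proof -
  define D where "D x = lam *\<^sub>C j x - Am1 x" for x
  have "bounded_linear D"
    using shifted_linear by (simp add: D_def[abs_def])
  then have "complete (range D)"
    by (rule complete_isometric_image[of 1, rotated 2])
      (simp_all add: D_def shifted_isometry complete_UNIV)
  then have closed: "closed {y. y \<in> range D}"
    by (simp add: complete_imp_closed)
  have "j z \<in> range D" for z
  proof -
    obtain y where y: "(R z, y) \<in> generator S" "lam *\<^sub>C R z - y = z"
      using resolvent_iff by blast
    have "D (R z) = j (lam *\<^sub>C R z - y)"
      unfolding D_def Am1_generator[OF y(1)] bounded_clinearD(2)[OF j_clinear]
        linear_diff[OF bounded_linear.linear[OF j_linear]] ..
    then have "j z = D (R z)" unfolding y(2) by (rule sym)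
    then show ?thesis by (rule image_eqI) simp
  qed
  then have "y \<in> range D"
    by (rule dense_range_induct[OF j_dense closed])
  then show ?thesis by (auto simp: D_def)
qed

text \<open>Constant inputs are always admissible: writing the input as \<open>(\<lambda> - A)
  x\<close>, the integral of its orbit becomes \<open>\<lambda>\<close> times an integral in X
  minus an increment of an orbit in X. This allows inputs to be cut off or delayed in a
  continuous way, with an error of this explicit kind.\<close>

lemma orbit_integral_regular:
  obtains c where "continuous_on {0..} c" "c 0 = 0"
    "\<And>t. 0 \<le> t \<Longrightarrow> j (c t) = integral {0..t} (\<lambda>s. Sm1 s y)"
    "\<And>t. 0 \<le> t \<Longrightarrow> norm (c t) \<le> (cmod lam * t * exp t + 2) * norm y"
proof -
  obtain x where x: "lam *\<^sub>C j x - Am1 x = y" using shifted_surj by blast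
  have nx: "norm x = norm y" using shifted_isometry[of x] x by simp
  define c where "c t = lam *\<^sub>C integral {0..t} (\<lambda>s. S s x) - (S t x - x)" for t
  show ?thesis
  proof (rule that[of c])
    have "continuous_on {0..} (\<lambda>t. integral {0..t} (\<lambda>s. S s x))"
      unfolding continuous_on_eq_continuous_within
      using integral_has_vector_derivative_halfline[OF X.continuous_orbit, of _ x] has_vector_derivative_continuous
      by blast
    then show "continuous_on {0..} c" unfolding c_def
      by (intro continuous_on_diff continuous_intros X.continuous_orbit
          bounded_linear.continuous_on[OF bounded_linear_scaleC]) auto
    show "c 0 = 0"
      using linear_0[OF bounded_linear.linear[OF bounded_linear_scaleC]] by (simp add: c_def)
    fix t :: real assume t: "0 \<le> t"
    have "integral {0..t} (\<lambda>s. Sm1 s y)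
        = integral {0..t} (\<lambda>s. lam *\<^sub>C Sm1 s (j x) - Sm1 s (Am1 x))"
      by (intro integral_cong) (simp add: Y.semigroup_diff bounded_clinearD(2)[OF Sm1_clinear] flip: x)
    also have "\<dots> = integral {0..t} (\<lambda>s. lam *\<^sub>C Sm1 s (j x)) - integral {0..t} (\<lambda>s. Sm1 s (Am1 x))"
      by (intro integral_diff integrable_continuous_real bounded_linear.continuous_on[OF bounded_linear_scaleC]
          Y.continuous_orbit) auto
    also have "integral {0..t} (\<lambda>s. lam *\<^sub>C Sm1 s (j x)) = integral {0..t} (\<lambda>s. j (lam *\<^sub>C S s x))"
      by (intro integral_cong) (simp add: Sm1_j bounded_clinearD(2)[OF j_clinear])
    also have "\<dots> = j (integral {0..t} (\<lambda>s. lam *\<^sub>C S s x))"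
      by (intro integral_linear_image[symmetric] j_linear bounded_linear.continuous_on[OF bounded_linear_scaleC]
          X.continuous_orbit) auto
    also have "integral {0..t} (\<lambda>s. lam *\<^sub>C S s x) = lam *\<^sub>C integral {0..t} (\<lambda>s. S s x)"
      by (intro integral_linear_image[symmetric] bounded_linear_scaleC X.continuous_orbit) auto
    also have "integral {0..t} (\<lambda>s. Sm1 s (Am1 x)) = j (S t x - x)"
      using t by (simp add: Sm1_increment[symmetric] Sm1_j linear_diff[OF bounded_linear.linear[OF j_linear]])
    finally show "j (c t) = integral {0..t} (\<lambda>s. Sm1 s y)"
      by (simp add: c_def linear_diff[OF bounded_linear.linear[OF j_linear]])
    have "norm (c t) \<le> norm (lam *\<^sub>C integral {0..t} (\<lambda>s. S s x)) + (norm (S t x) + norm x)"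
      unfolding c_def using norm_triangle_ineq4[of "S t x" x]
      by (rule order_trans[OF norm_triangle_ineq4 add_left_mono])
    also have "\<dots> \<le> cmod lam * (exp t * norm x * t) + (norm x + norm x)"
      unfolding norm_scaleC using X.norm_orbit_integral[OF t, of x] contr[OF t, of x]
      by (intro add_mono mult_left_mono) auto
    finally show "norm (c t) \<le> (cmod lam * t * exp t + 2) * norm y"
      by (simp add: nx algebra_simps)
  qed
qed

end

section \<open>Automatic boundedness and continuous inputs\<close>

lemma Baire_closed_cover:
  fixes F :: "nat \<Rightarrow> 'e::complete_space set"
  assumes "\<And>n. closed (F n)" "(\<Union>n. F n) = UNIV"
  shows "\<exists>n. interior (F n) \<noteq> {}"
proof (rule ccontr)
  assume "\<not> ?thesis"
  then have "\<And>n. interior (F n) = {}" by blast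
  then have "Met_TC.mtopology interior_of (\<Union>(range F)) = {}"
    using assms(1)
    by (intro Met_TC.metric_Baire_category_alt)
      (auto simp: complete_UNIV)
  then show False using assms(2) by simp
qed

text \<open>A form of the closed graph theorem. By Baire, the set of \<open>u\<close> whose
  image has a preimage of norm at most \<open>n\<close> is dense in a ball for some
  \<open>n\<close>; since these sets are convex and symmetric the ball may be centred at 0. Each
  \<open>u\<close> is then approximated up to half its norm, with control on the preimage, and
  iterating the approximation yields an absolutely convergent series of preimages.\<close>

lemma bounded_lift_through_injection:
  fixes \<Psi> :: "'e::{real_normed_vector, complete_space} \<Rightarrow> 'y::real_normed_vector" and j :: "'x::banach \<Rightarrow> 'y"
  assumes \<Psi>: "bounded_linear \<Psi>" and j: "bounded_linear j" and lift: "\<And>u. \<exists>x. j x = \<Psi> u"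
  obtains M where "0 \<le> M" "\<And>u. \<exists>x. j x = \<Psi> u \<and> norm x \<le> M * norm u"
proof -
  interpret \<Psi>: bounded_linear \<Psi> by fact
  interpret j: bounded_linear j by fact
  define G where "G n = {u. \<exists>x. j x = \<Psi> u \<and> norm x \<le> real n}" for n
  have "(\<Union>n. closure (G n)) = UNIV"
  proof -
    have "u \<in> (\<Union>n. closure (G n))" for u
    proof -
      obtain x where "j x = \<Psi> u" using lift by blast
      moreover obtain n where "norm x \<le> real n" using real_arch_simple by blast
      ultimately have "u \<in> G n" by (auto simp: G_def)
      then show ?thesis using closure_subset by blast
    qed
    then show ?thesis by blast
  qed
  then obtain n u0 where "u0 \<in> interior (closure (G n))"
    using Baire_closed_cover[of "\<lambda>n. closure (G n)"] by auto
  then obtain r where r: "0 < r" "ball u0 r \<subseteq> closure (G n)"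
    by (auto simp: mem_interior)
  \<comment> \<open>Averaging approximations of u0 + u and of the reflected point u0 - u moves
    the centre of the ball to 0.\<close>
  have approx: "\<exists>v\<in>G n. norm (u - v) < e" if "norm u < r" "0 < e" for u e
  proof -
    have "u0 + u \<in> closure (G n)" "u0 - u \<in> closure (G n)"
      using that r(2) by (auto simp: subset_iff dist_norm)
    then obtain v w where vw: "v \<in> G n" "dist v (u0 + u) < e" "w \<in> G n" "dist w (u0 - u) < e"
      using \<open>0 < e\<close> unfolding closure_approachable by blast
    then obtain x y where xy: "j x = \<Psi> v" "norm x \<le> real n" "j y = \<Psi> w" "norm y \<le> real n"
      by (auto simp: G_def)
    have "norm ((1 / 2) *\<^sub>R (x - y)) \<le> real n"
      using norm_triangle_ineq4[of x y] xy by simp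
    moreover have "j ((1 / 2) *\<^sub>R (x - y)) = \<Psi> ((1 / 2) *\<^sub>R (v - w))"
      by (simp add: j.scaleR j.diff \<Psi>.scaleR \<Psi>.diff xy)
    ultimately have "(1 / 2) *\<^sub>R (v - w) \<in> G n"
      unfolding G_def by blast
    moreover have "norm (u - (1 / 2) *\<^sub>R (v - w)) < e"
    proof -
      have "u - (1 / 2) *\<^sub>R (v - w) = (1 / 2) *\<^sub>R ((u0 + u - v) - (u0 - u - w))"
      proof -
        have "(u0 + u - v) - (u0 - u - w) = (u + u) - (v - w)" by simp
        then show ?thesis by (simp only: scaleR_diff_right[of _ "u + u"] scaleR_half_double)
      qed
      also have "norm \<dots> \<le> (1 / 2) * (norm (u0 + u - v) + norm (u0 - u - w))"
        using norm_triangle_ineq4[of "u0 + u - v" "u0 - u - w"] by simp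
      also have "\<dots> < e"
        using vw by (simp add: dist_norm norm_minus_commute)
      finally show ?thesis .
    qed
    ultimately show ?thesis by blast
  qed
  define K where "K = 2 * real n / r"
  have K0: "0 \<le> K" using r by (simp add: K_def)
  have "\<exists>v x. j x = \<Psi> v \<and> norm x \<le> K * norm u \<and> norm (u - v) \<le> norm u / 2" for u
  proof (cases "u = 0")
    case True
    then show ?thesis
      by (intro exI[of _ 0]) (simp add: j.zero \<Psi>.zero)
  next
    case False
    define a where "a = r / (2 * norm u)"
    have a: "0 < a" "a * norm u = r / 2" using False r by (auto simp: a_def)
    have "norm (a *\<^sub>R u) < r" using a r by simp
    then obtain v x where v: "norm (a *\<^sub>R u - v) < r / 4" and x: "j x = \<Psi> v" "norm x \<le> real n"
      using approx[of "a *\<^sub>R u" "r / 4"] r(1) by (auto simp: G_def)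
    have "norm (u - v /\<^sub>R a) = norm (a *\<^sub>R u - v) / a"
    proof -
      have "u - v /\<^sub>R a = (a *\<^sub>R u - v) /\<^sub>R a" using a by (simp add: scaleR_diff_right)
      then have "norm (u - v /\<^sub>R a) = \<bar>inverse a\<bar> * norm (a *\<^sub>R u - v)" by (simp only: norm_scaleR)
      then show ?thesis using a by (simp add: field_simps)
    qed
    also have "\<dots> \<le> (r / 4) / a" using v a by (intro divide_right_mono) auto
    also have "\<dots> = norm u / 2" using False r by (simp add: a_def)
    finally have "norm (u - v /\<^sub>R a) \<le> norm u / 2" .
    moreover have "j (x /\<^sub>R a) = \<Psi> (v /\<^sub>R a)" using x by (simp add: j.scaleR \<Psi>.scaleR)
    moreover have "norm (x /\<^sub>R a) \<le> K * norm u"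
    proof -
      have "norm (x /\<^sub>R a) = norm x / a" using a by (simp add: field_simps)
      also have "\<dots> \<le> real n / a" using x a by (simp add: divide_right_mono)
      also have "\<dots> = K * norm u" using False r by (simp add: a_def K_def)
      finally show ?thesis .
    qed
    ultimately show ?thesis by blast
  qed
  then obtain v x where
    step: "\<And>u. j (x u) = \<Psi> (v u)" "\<And>u. norm (x u) \<le> K * norm u" "\<And>u. norm (u - v u) \<le> norm u / 2"
    by metis
  have "\<exists>y. j y = \<Psi> u \<and> norm y \<le> (2 * K) * norm u" for u
  proof -
    \<comment> \<open>U k is the part of u left after k approximation steps; its norm is
      halved in each step.\<close>
    define U where "U k = ((\<lambda>u. u - v u) ^^ k) u" for k
    have U_Suc: "U (Suc k) = U k - v (U k)" for k by (simp add: U_def)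
    have nU: "norm (U k) \<le> (1 / 2) ^ k * norm u" for k
    proof (induction k)
      case (Suc k)
      have "norm (U (Suc k)) \<le> norm (U k) / 2" using step(3) by (simp add: U_Suc)
      then show ?case using Suc by simp
    qed (simp add: U_def)
    have nx: "norm (x (U k)) \<le> K * norm u * (1 / 2) ^ k" for k
      using order_trans[OF step(2) mult_left_mono[OF nU K0]] by (simp add: mult_ac)
    have geo: "(\<lambda>k. K * norm u * (1 / 2) ^ k) sums (K * norm u * 2)"
      using sums_mult[OF geometric_sums[of "1 / 2 :: real"], of "K * norm u"] by simp
    have sn: "summable (\<lambda>k. norm (x (U k)))"
      by (rule summable_comparison_test'[OF sums_summable[OF geo]]) (simp add: nx)
    have "norm (\<Sum>k. x (U k)) \<le> (\<Sum>k. norm (x (U k)))"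
      by (rule summable_norm[OF sn])
    also have "\<dots> \<le> K * norm u * 2"
      using suminf_le[OF nx sn sums_summable[OF geo]] sums_unique[OF geo] by simp
    finally have bound: "norm (\<Sum>k. x (U k)) \<le> 2 * K * norm u" by simp
    have partial: "j (\<Sum>k<m. x (U k)) = \<Psi> u - \<Psi> (U m)" for m
    proof (induction m)
      case 0
      have "U 0 = u" by (simp add: U_def)
      then show ?case by (simp add: j.zero)
    next
      case (Suc m)
      then show ?case by (simp add: U_Suc j.add step(1) \<Psi>.diff)
    qed
    have "(\<lambda>m. j (\<Sum>k<m. x (U k))) \<longlonglongrightarrow> j (\<Sum>k. x (U k))"
      by (rule j.tendsto[OF summable_LIMSEQ[OF summable_norm_cancel[OF sn]]])
    moreover have "(\<lambda>m. \<Psi> u - \<Psi> (U m)) \<longlonglongrightarrow> \<Psi> u - \<Psi> 0"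
    proof (intro tendsto_diff tendsto_const \<Psi>.tendsto)
      have "(\<lambda>m. (1 / 2) ^ m * norm u) \<longlonglongrightarrow> 0 * norm u"
        by (intro tendsto_mult_right LIMSEQ_power_zero) simp
      then have lim: "(\<lambda>m. (1 / 2) ^ m * norm u) \<longlonglongrightarrow> 0" by simp
      show "U \<longlonglongrightarrow> 0"
        by (rule Lim_null_comparison[OF _ lim]) (simp add: nU)
    qed
    ultimately have "j (\<Sum>k. x (U k)) = \<Psi> u"
      by (simp add: partial \<Psi>.zero LIMSEQ_unique)
    then show ?thesis using bound by blast
  qed
  then show ?thesis using that[of "2 * K"] K0 by simp
qed

text \<open>A continuous function composed with simple functions converging to the identity is a
  sequence of simple functions converging to it, so strong measurability holds in non-separable
  spaces too.\<close>

lemma continuous_Lp_functions: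
  fixes u :: "real \<Rightarrow> 'x::real_normed_vector"
  assumes u: "continuous_on UNIV u" and p: "0 < p"
  shows "u \<in> Lp_functions p T"
  unfolding Lp_functions_def
proof (intro CollectI conjI)
  have "(\<lambda>x::real. x) \<in> borel_measurable (lebesgue_on {0..T})"
    by (intro continuous_imp_measurable_on_sets_lebesgue continuous_intros) auto
  then obtain F :: "nat \<Rightarrow> real \<Rightarrow> real" where
    F: "\<And>i. simple_function (lebesgue_on {0..T}) (F i)"
      "\<And>x. x \<in> space (lebesgue_on {0..T}) \<Longrightarrow> (\<lambda>i. F i x) \<longlonglongrightarrow> x"
    using borel_measurable_implies_sequence_metric[of "\<lambda>x. x" _ 0] by blast
  have "(\<lambda>n. (u \<circ> F n) s) \<longlonglongrightarrow> u s" if "s \<in> space (lebesgue_on {0..T})" for s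
    unfolding o_def using u F(2)[OF that]
    by (intro isCont_tendsto_compose[of s u]) (simp_all add: continuous_on_eq_continuous_at)
  moreover have "simple_function (lebesgue_on {0..T}) (u \<circ> F n)" for n
    by (intro simple_function_compose F)
  ultimately show "strongly_measurable (lebesgue_on {0..T}) u"
    unfolding strongly_measurable_def by (intro exI[of _ "\<lambda>n. u \<circ> F n"] conjI allI AE_I2) auto
  show "integrable (lebesgue_on {0..T}) (\<lambda>s. norm (u s) powr p)"
    using p by (intro continuous_imp_integrable_real continuous_on_powr' continuous_intros
        continuous_on_subset[OF u]) auto
qed

section \<open>The input-to-state map\<close>

locale control_system = extrapolated_semigroup S lam j Am1 Sm1
  for S :: "real \<Rightarrow> 'x::complex_banach \<Rightarrow> 'x"
    and lam :: complex
    and j :: "'x \<Rightarrow> 'y::complex_banach"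
    and Am1 :: "'x \<Rightarrow> 'y"
    and Sm1 :: "real \<Rightarrow> 'y \<Rightarrow> 'y" +
  fixes B :: "'x \<Rightarrow> 'y"
  assumes B_clinear: "bounded_clinear B"
begin

lemmas B_linear = bounded_clinearD(1)[OF B_clinear]

text \<open>The input-to-state map \<open>\<Phi> t u\<close> with values in the extrapolation
  space, written with the substitution \<open>s \<mapsto> t - s\<close>: in this form the
  semigroup does not depend on the final time, so splitting the interval of integration
  corresponds to shifting or delaying the input.\<close>

definition conv :: "real \<Rightarrow> (real \<Rightarrow> 'x) \<Rightarrow> 'y"
  where "conv t u = integral {0..t} (\<lambda>s. Sm1 s (B (u (t - s))))"

lemma continuous_integrand:
  assumes "continuous_on {0..t} u"
  shows "continuous_on {0..t} (\<lambda>s. Sm1 s (B (u (t - s))))"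
proof (rule Y.continuous_joint)
  have "continuous_on {0..t} (\<lambda>s. u (t - s))"
    by (rule continuous_on_compose2[OF assms]) (auto intro: continuous_intros)
  then show "continuous_on {0..t} (\<lambda>s. B (u (t - s)))"
    by (rule bounded_linear.continuous_on[OF B_linear])
qed (auto intro: continuous_intros)

lemma conv_cong:
  assumes "\<And>s. 0 \<le> s \<Longrightarrow> s \<le> t \<Longrightarrow> u s = v s"
  shows "conv t u = conv t v"
  unfolding conv_def using assms by (intro integral_cong) auto

lemma conv_add_scale:
  assumes u: "continuous_on {0..t} u" and v: "continuous_on {0..t} v"
  shows "conv t (\<lambda>s. u s + a *\<^sub>C v s) = conv t u + a *\<^sub>C conv t v"
proof -
  have "conv t (\<lambda>s. u s + a *\<^sub>C v s)
      = integral {0..t} (\<lambda>s. Sm1 s (B (u (t - s))) + a *\<^sub>C Sm1 s (B (v (t - s))))"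
    unfolding conv_def
    by (intro integral_cong) (simp add: linear_add[OF bounded_linear.linear[OF B_linear]]
        linear_add[OF bounded_linear.linear[OF Sm1_linear]] bounded_clinearD(2)[OF B_clinear]
        bounded_clinearD(2)[OF Sm1_clinear])
  also have "\<dots> = conv t u + integral {0..t} (\<lambda>s. a *\<^sub>C Sm1 s (B (v (t - s))))"
    unfolding conv_def
    by (intro integral_add integrable_continuous_real continuous_integrand u v
        bounded_linear.continuous_on[OF bounded_linear_scaleC])
  also have "integral {0..t} (\<lambda>s. a *\<^sub>C Sm1 s (B (v (t - s)))) = a *\<^sub>C conv t v"
    unfolding conv_def
    by (intro integral_linear_image[symmetric] bounded_linear_scaleC continuous_integrand v)
  finally show ?thesis .
qed

text \<open>The variation of constants formula: the state reached by time \<open>s\<close> is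
  evolved freely, while the rest of the input acts from zero initial state.\<close>

lemma conv_shift:
  assumes u: "continuous_on {0..t + s} u" and t: "0 \<le> t" "0 \<le> s"
  shows "conv (t + s) u = Sm1 t (conv s u) + conv t (\<lambda>r. u (s + r))"
proof -
  let ?f = "\<lambda>r. Sm1 r (B (u (t + s - r)))"
  have "conv (t + s) u = integral {0..t} ?f + integral {t..t + s} ?f"
    unfolding conv_def using t
    by (intro Henstock_Kurzweil_Integration.integral_combine[symmetric] integrable_continuous_real
        continuous_integrand u) auto
  also have "integral {0..t} ?f = conv t (\<lambda>r. u (s + r))"
    unfolding conv_def by (intro integral_cong) (simp add: algebra_simps)
  also have "integral {t..t + s} ?f = integral {0..s} (\<lambda>r. ?f (r + t))"
    using integral_shift_real_ivl[of t t "t + s" ?f] by simp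
  also have "\<dots> = integral {0..s} (\<lambda>r. Sm1 t (Sm1 r (B (u (s - r)))))"
    using t by (intro integral_cong) (simp add: add.commute[of _ t] Y.semigroup_add)
  also have "\<dots> = Sm1 t (conv s u)"
    unfolding conv_def using t
    by (intro integral_linear_image[symmetric] Sm1_linear continuous_integrand continuous_on_subset[OF u]) auto
  finally show ?thesis by simp
qed

lemma norm_conv:
  assumes u: "continuous_on {0..t} u" and t: "0 \<le> t"
    and K: "\<And>s. 0 \<le> s \<Longrightarrow> s \<le> t \<Longrightarrow> norm (u s) \<le> K"
  shows "norm (conv t u) \<le> onorm B * K * t"
proof -
  have bound: "norm (Sm1 s (B (u (t - s)))) \<le> onorm B * K" if "s \<in> {0..t}" for s
  proof -
    have "norm (Sm1 s (B (u (t - s)))) \<le> norm (B (u (t - s)))"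
      using that by (intro Sm1_contr) auto
    also have "\<dots> \<le> onorm B * norm (u (t - s))" by (rule onorm[OF B_linear])
    also have "\<dots> \<le> onorm B * K"
      using that by (intro mult_left_mono K onorm_pos_le[OF B_linear]) auto
    finally show ?thesis .
  qed
  show ?thesis
    unfolding conv_def using integral_bound[OF t continuous_integrand[OF u] bound] by simp
qed

text \<open>Delaying the input by \<open>h\<close>, with the initial value held during the
  delay, changes its effect only by the effect of a constant input. This compares effects at
  different times and also reduces times \<open>t \<le> T\<close> to the time \<open>T\<close>
  at which admissibility is given.\<close>

lemma conv_delay:
  assumes u: "continuous_on {0..t} u" and th: "0 \<le> t" "0 \<le> h"
    and c: "\<And>t. 0 \<le> t \<Longrightarrow> j (c t) = integral {0..t} (\<lambda>s. Sm1 s (B (u 0)))"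
  shows "conv (t + h) (\<lambda>r. u (max 0 (r - h))) = conv t u + j (c (t + h) - c t)"
proof -
  let ?v = "\<lambda>r. u (max 0 (r - h))"
  let ?f = "\<lambda>s. Sm1 s (B (u (max 0 (t + h - s - h))))"
  have v: "continuous_on {0..t + h} ?v"
    using th by (intro continuous_on_compose2[OF u]) (auto intro!: continuous_intros)
  have "conv (t + h) ?v = integral {0..t} ?f + integral {t..t + h} ?f"
    unfolding conv_def using th
    by (intro Henstock_Kurzweil_Integration.integral_combine[symmetric] integrable_continuous_real
        continuous_integrand[OF v]) auto
  also have "integral {0..t} ?f = conv t u"
    unfolding conv_def by (intro integral_cong) (simp add: max_def)
  also have "integral {t..t + h} ?f = integral {t..t + h} (\<lambda>s. Sm1 s (B (u 0)))"
    by (intro integral_cong) (simp add: max.absorb1)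
  also have "\<dots> = j (c (t + h)) - j (c t)"
    using th Henstock_Kurzweil_Integration.integral_combine[where f = "\<lambda>s. Sm1 s (B (u 0))" and a = 0 and c = t and b = "t + h"]
      integrable_continuous_real[OF Y.continuous_orbit[of "{0..t + h}" "B (u 0)"]]
    by (simp add: c algebra_simps)
  finally show ?thesis
    by (simp add: linear_diff[OF bounded_linear.linear[OF j_linear]])
qed

text \<open>Over a short time a continuous input acts like its initial value, for which the
  average of an orbit converges.\<close>

lemma conv_average_tendsto:
  assumes u: "continuous_on {0..} u"
  shows "((\<lambda>h. conv h u /\<^sub>R h) \<longlongrightarrow> B (u 0)) (at_right 0)"
proof -
  have "((\<lambda>h. (conv h u - conv h (\<lambda>_. u 0)) /\<^sub>R h) \<longlongrightarrow> 0) (at_right 0)"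
  proof (rule tendstoI)
    fix e :: real assume e: "0 < e"
    define e' where "e' = e / (2 * (onorm B + 1))"
    have B0: "0 \<le> onorm B" by (rule onorm_pos_le[OF B_linear])
    have e': "0 < e'" "onorm B * e' < e" using e B0 by (auto simp: e'_def field_simps add_nonneg_pos)
    have "(u \<longlongrightarrow> u 0) (at 0 within {0..})"
      using u by (auto simp: continuous_on_def)
    then have "(u \<longlongrightarrow> u 0) (at_right 0)" by (simp add: at_within_Ici_at_right)
    then have "\<forall>\<^sub>F s in at_right 0. dist (u s) (u 0) < e'" using e'(1) by (rule tendstoD)
    then obtain d where d: "0 < d" "\<And>s. 0 < s \<Longrightarrow> s < d \<Longrightarrow> dist (u s) (u 0) < e'"
      unfolding eventually_at_right[OF zero_less_one] by auto
    have "dist ((conv h u - conv h (\<lambda>_. u 0)) /\<^sub>R h) 0 < e" if h: "0 < h" "h < d" for h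
    proof -
      have uh: "continuous_on {0..h} u" by (rule continuous_on_subset[OF u]) auto
      have "norm (conv h (\<lambda>s. u s + (- 1) *\<^sub>C u 0)) \<le> onorm B * e' * h"
      proof (rule norm_conv)
        show "continuous_on {0..h} (\<lambda>s. u s + (- 1) *\<^sub>C u 0)" by (intro continuous_intros uh)
        fix s assume "0 \<le> s" "s \<le> h"
        then show "norm (u s + (- 1) *\<^sub>C u 0) \<le> e'"
          using d(2)[of s] h e'(1)
          by (cases "s = 0") (auto simp: dist_norm)
      qed (use h in auto)
      also have "conv h (\<lambda>s. u s + (- 1) *\<^sub>C u 0) = conv h u - conv h (\<lambda>_. u 0)"
        using conv_add_scale[OF uh continuous_on_const, of "- 1" "u 0"]
        by simp
      finally have "norm (conv h u - conv h (\<lambda>_. u 0)) / h \<le> onorm B * e'"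
        using h by (simp add: field_simps)
      also have "\<dots> < e" by (rule e'(2))
      finally show ?thesis using h by (simp add: divide_inverse mult.commute)
    qed
    then show "\<forall>\<^sub>F h in at_right 0. dist ((conv h u - conv h (\<lambda>_. u 0)) /\<^sub>R h) 0 < e"
      using d(1) unfolding eventually_at_right[OF zero_less_one] by blast
  qed
  moreover have "((\<lambda>h. integral {0..0 + h} (\<lambda>s. Sm1 s (B (u 0))) /\<^sub>R h) \<longlongrightarrow> Sm1 0 (B (u 0))) (at_right 0)"
    by (intro average_tendsto Y.continuous_orbit) auto
  ultimately have "((\<lambda>h. (conv h u - conv h (\<lambda>_. u 0)) /\<^sub>R h + conv h (\<lambda>_. u 0) /\<^sub>R h) \<longlongrightarrow> 0 + B (u 0)) (at_right 0)"
    by (intro tendsto_add) (simp_all add: conv_def)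
  then show ?thesis by (simp flip: scaleR_add_right)
qed

text \<open>The admissibility condition is qualitative: each input is mapped into the range of
  \<open>j\<close>. On the complete space of bounded continuous inputs the closed graph theorem
  makes it quantitative at time \<open>T\<close>. An input on \<open>[0, t]\<close> is turned
  into one on \<open>[0, T]\<close> by a delay.\<close>

lemma conv_bound_on_block:
  assumes T: "0 < T" and p: "0 < p" and adm: "p_admissible p T j Sm1 B"
  obtains M where "0 \<le> M"
    "\<And>t u K. 0 \<le> t \<Longrightarrow> t \<le> T \<Longrightarrow> continuous_on {0..t} u \<Longrightarrow>
      (\<And>s. 0 \<le> s \<Longrightarrow> s \<le> t \<Longrightarrow> norm (u s) \<le> K) \<Longrightarrow> \<exists>x. j x = conv t u \<and> norm x \<le> M * K"
proof -
  define \<Psi> where "\<Psi> w = conv T (apply_bcontfun w)" for w :: "real \<Rightarrow>\<^sub>C 'x"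
  have bl: "bounded_linear \<Psi>"
  proof (rule bounded_linear_intro)
    fix v w :: "real \<Rightarrow>\<^sub>C 'x" and r :: real
    show "\<Psi> (v + w) = \<Psi> v + \<Psi> w"
      using conv_add_scale[where t = T and u = "apply_bcontfun v" and v = "apply_bcontfun w" and a = 1]
      by (simp add: \<Psi>_def plus_bcontfun.rep_eq)
    have z: "conv T (\<lambda>s. 0) = 0"
    proof -
      have "norm (conv T (\<lambda>s. 0)) \<le> onorm B * 0 * T"
        using T by (intro norm_conv) auto
      then show ?thesis by simp
    qed
    show "\<Psi> (r *\<^sub>R v) = r *\<^sub>R \<Psi> v"
      using conv_add_scale[where t = T and u = "\<lambda>s. 0" and v = "apply_bcontfun v" and a = "complex_of_real r"]
      by (simp add: \<Psi>_def scaleR_bcontfun.rep_eq z scaleC_of_real)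
    show "norm (\<Psi> v) \<le> norm v * (onorm B * T)"
      using norm_conv[of T v "norm v"] T by (simp add: \<Psi>_def norm_bounded mult_ac)
  qed
  have lift: "\<exists>x. j x = \<Psi> w" for w
  proof -
    have "apply_bcontfun w \<in> Lp_functions p T"
      using p by (intro continuous_Lp_functions) auto
    then obtain x where "((\<lambda>s. Sm1 (T - s) (B (w s))) has_integral j x) {0..T}"
      using adm by (auto simp: p_admissible_def)
    from has_integral_reverse[OF this] have "j x = \<Psi> w"
      by (simp add: \<Psi>_def conv_def integral_unique)
    then show ?thesis by blast
  qed
  obtain M where M: "0 \<le> M" "\<And>w. \<exists>x. j x = \<Psi> w \<and> norm x \<le> M * norm w"
    by (rule bounded_lift_through_injection[OF bl j_linear lift, rule_format]) (rule that)
  define M' where "M' = M + 2 * ((cmod lam * T * exp T + 2) * onorm B)"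
  show ?thesis
  proof (rule that[of M'])
    show "0 \<le> M'" using M(1) T onorm_pos_le[OF B_linear] by (simp add: M'_def)
    fix t K :: real and u :: "real \<Rightarrow> 'x"
    assume t: "0 \<le> t" "t \<le> T" and u: "continuous_on {0..t} u"
      and K: "\<And>s. 0 \<le> s \<Longrightarrow> s \<le> t \<Longrightarrow> norm (u s) \<le> K"
    define w where "w r = u (max 0 (min t (r - (T - t))))" for r
    have w: "continuous_on UNIV w" unfolding w_def
      using t by (intro continuous_on_compose2[OF u]) (auto intro!: continuous_intros)
    have nw: "norm (w r) \<le> K" for r
      unfolding w_def using t by (intro K) auto
    have bw: "w \<in> bcontfun" by (rule bcontfun_normI[OF w nw])
    have nBw: "norm (Bcontfun w) \<le> K"
      by (rule norm_bound) (simp add: Bcontfun_inverse[OF bw] nw)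
    obtain x where x: "j x = conv T w" "norm x \<le> M * norm (Bcontfun w)"
      using M(2)[of "Bcontfun w"] by (auto simp: \<Psi>_def Bcontfun_inverse[OF bw])
    have nx: "norm x \<le> M * K"
      by (rule order_trans[OF x(2) mult_left_mono[OF nBw M(1)]])
    obtain c where "continuous_on {0..} c" "c 0 = 0"
      and c: "\<And>t. 0 \<le> t \<Longrightarrow> j (c t) = integral {0..t} (\<lambda>s. Sm1 s (B (u 0)))"
      "\<And>t. 0 \<le> t \<Longrightarrow> norm (c t) \<le> (cmod lam * t * exp t + 2) * norm (B (u 0))"
      by (rule orbit_integral_regular[of "B (u 0)"]) (rule that)
    have nc: "norm (c s) \<le> (cmod lam * T * exp T + 2) * (onorm B * K)" if "0 \<le> s" "s \<le> T" for s
    proof -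
      have "norm (B (u 0)) \<le> onorm B * K"
        using t by (intro order_trans[OF onorm[OF B_linear] mult_left_mono] K onorm_pos_le[OF B_linear]) auto
      moreover have "cmod lam * s * exp s + 2 \<le> cmod lam * T * exp T + 2"
        using that T by (intro add_right_mono mult_mono) auto
      ultimately show ?thesis
        using that T by (intro order_trans[OF c(2)] mult_mono) auto
    qed
    have "conv T w = conv (t + (T - t)) (\<lambda>r. u (max 0 (r - (T - t))))"
      using t unfolding w_def by (simp, intro conv_cong) (auto simp: min_def)
    also have "\<dots> = conv t u + j (c (t + (T - t)) - c t)"
      using t by (intro conv_delay u c(1)) auto
    finally have "j (x - (c T - c t)) = conv t u"
      using x(1) by (simp add: linear_diff[OF bounded_linear.linear[OF j_linear]])
    moreover have "norm (x - (c T - c t)) \<le> M' * K"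
    proof -
      have "norm (x - (c T - c t)) \<le> norm x + (norm (c T) + norm (c t))"
        by (rule order_trans[OF norm_triangle_ineq4 add_left_mono[OF norm_triangle_ineq4]])
      also have "\<dots> \<le> M * K + ((cmod lam * T * exp T + 2) * (onorm B * K) + (cmod lam * T * exp T + 2) * (onorm B * K))"
        using t T by (intro add_mono nx nc) auto
      also have "\<dots> = M' * K" by (simp add: M'_def algebra_simps)
      finally show ?thesis .
    qed
    ultimately show "\<exists>x. j x = conv t u \<and> norm x \<le> M' * K" by blast
  qed
qed

text \<open>Admissibility uniformly in time. Inputs growing like \<open>exp s\<close> are sent
  to states growing like \<open>exp t\<close>, with one constant for all times; in the norm
  weighted by \<open>exp (- t)\<close> this makes the Volterra equation of the perturbed system
  a contraction on the whole half-line.\<close>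

definition weighted_bound :: "real \<Rightarrow> bool"
  where "weighted_bound M \<longleftrightarrow> 0 \<le> M \<and>
    (\<forall>t\<ge>0. \<forall>u K. continuous_on {0..t} u \<and> (\<forall>s\<in>{0..t}. norm (u s) \<le> K * exp s) \<longrightarrow>
      (\<exists>x. j x = conv t u \<and> norm x \<le> M * K * exp t))"

text \<open>Advance in blocks of length \<open>T\<close>. Free evolution is contractive, so in
  the weighted norm the old contribution shrinks by \<open>exp (- T)\<close> per block and the
  contributions sum to a geometric series with value \<open>M / (1 - exp (- T))\<close>.\<close>

lemma ex_weighted_bound:
  assumes T: "0 < T" and p: "0 < p" and adm: "p_admissible p T j Sm1 B"
  shows "\<exists>M. weighted_bound M"
proof -
  obtain M where M: "0 \<le> M"
    "\<And>t u K. 0 \<le> t \<Longrightarrow> t \<le> T \<Longrightarrow> continuous_on {0..t} u \<Longrightarrow>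
      (\<And>s. 0 \<le> s \<Longrightarrow> s \<le> t \<Longrightarrow> norm (u s) \<le> K) \<Longrightarrow> \<exists>x. j x = conv t u \<and> norm x \<le> M * K"
    using conv_bound_on_block[OF assms] by blast
  define M' where "M' = M / (1 - exp (- T))"
  have e: "0 < 1 - exp (- T)" using T by simp
  have M': "M' * exp (- T) + M = M'" "M \<le> M'" "0 \<le> M'"
  proof -
    show "M' * exp (- T) + M = M'" using e by (simp add: M'_def field_simps)
    show "0 \<le> M'" using e M(1) by (simp add: M'_def)
    then have "0 \<le> M' * exp (- T)" by simp
    then show "M \<le> M'" using \<open>M' * exp (- T) + M = M'\<close> by linarith
  qed
  have blocks: "\<exists>x. j x = conv t u \<and> norm x \<le> M' * K * exp t"
    if "0 \<le> t" "t \<le> real (Suc n) * T" "continuous_on {0..t} u"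
      "\<And>s. 0 \<le> s \<Longrightarrow> s \<le> t \<Longrightarrow> norm (u s) \<le> K * exp s" for n t u K
    using that
  proof (induction n arbitrary: t)
    case (0 t)
    have K: "0 \<le> K" using order_trans[OF norm_ge_zero 0(4)[of 0]] 0(1) by simp
    have "norm (u s) \<le> K * exp t" if "0 \<le> s" "s \<le> t" for s
      using 0(4)[OF that] that K by (auto intro: order_trans mult_left_mono)
    then obtain x where x: "j x = conv t u" "norm x \<le> M * (K * exp t)"
      using M(2)[OF 0(1) _ 0(3), of "K * exp t"] 0(2) by auto
    have "M * (K * exp t) \<le> M' * (K * exp t)"
      using K M'(2) by (intro mult_right_mono) auto
    then show ?case using x by (intro exI[of _ x]) (simp add: mult.assoc)
  next
    case (Suc n t)
    have K: "0 \<le> K" using order_trans[OF norm_ge_zero Suc.prems(4)[of 0]] Suc.prems(1) by simp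
    show ?case
    proof (cases "t \<le> T")
      case True
      have "norm (u s) \<le> K * exp t" if "0 \<le> s" "s \<le> t" for s
        using Suc.prems(4)[OF that] that K by (auto intro: order_trans mult_left_mono)
      then obtain x where x: "j x = conv t u" "norm x \<le> M * (K * exp t)"
        using M(2)[OF Suc.prems(1) True Suc.prems(3), of "K * exp t"] by auto
      have "M * (K * exp t) \<le> M' * (K * exp t)"
        using K M'(2) by (intro mult_right_mono) auto
      then show ?thesis using x by (intro exI[of _ x]) (simp add: mult.assoc)
    next
      case False
      define s where "s = t - T"
      have s: "0 \<le> s" "t = T + s" "s \<le> t" using False T by (auto simp: s_def)
      have "s \<le> real (Suc n) * T" using Suc.prems(2) by (simp add: s_def algebra_simps)
      then obtain x where x: "j x = conv s u" "norm x \<le> M' * K * exp s"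
        using Suc.IH[OF s(1) _ continuous_on_subset[OF Suc.prems(3)], of ] Suc.prems(4) s by fastforce
      have cont: "continuous_on {0..T} (\<lambda>r. u (s + r))"
        using s by (intro continuous_on_compose2[OF Suc.prems(3)]) (auto intro!: continuous_intros)
      have "norm (u (s + r)) \<le> K * exp t" if "0 \<le> r" "r \<le> T" for r
      proof -
        have "norm (u (s + r)) \<le> K * exp (s + r)" using that s by (intro Suc.prems(4)) auto
        also have "\<dots> \<le> K * exp t" using that s K by (intro mult_left_mono) auto
        finally show ?thesis .
      qed
      then obtain y where y: "j y = conv T (\<lambda>r. u (s + r))" "norm y \<le> M * (K * exp t)"
        using M(2)[OF _ order_refl cont, of "K * exp t"] T by auto
      have "j (S T x + y) = conv t u"
        using conv_shift[of T s u] Suc.prems(3) s T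
        by (simp add: x(1)[symmetric] y(1)[symmetric] Sm1_j linear_add[OF bounded_linear.linear[OF j_linear]])
      moreover have "norm (S T x + y) \<le> M' * K * exp t"
      proof -
        have "norm (S T x + y) \<le> norm x + norm y"
          using contr[of T x] T norm_triangle_ineq[of "S T x" y] by linarith
        also have "\<dots> \<le> M' * K * exp s + M * (K * exp t)" using x y by linarith
        also have "exp s = exp (- T) * exp t" using s by (simp add: exp_add exp_minus)
        also have "M' * K * (exp (- T) * exp t) + M * (K * exp t) = (M' * exp (- T) + M) * K * exp t"
          by (simp add: algebra_simps)
        finally show ?thesis by (simp add: M'(1))
      qed
      ultimately show ?thesis by blast
    qed
  qed
  have cover: "\<exists>n. t \<le> real (Suc n) * T" for t
  proof -
    obtain n where "t / T \<le> real n" using real_arch_simple by blast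
    then have "t \<le> real n * T" using T by (simp add: field_simps)
    then show ?thesis using T by (intro exI[of _ n]) (simp add: algebra_simps)
  qed
  have "weighted_bound M'"
    unfolding weighted_bound_def
  proof (intro conjI allI impI M'(3))
    fix t K :: real and u :: "real \<Rightarrow> 'x"
    assume t: "0 \<le> t" and u: "continuous_on {0..t} u \<and> (\<forall>s\<in>{0..t}. norm (u s) \<le> K * exp s)"
    obtain n where "t \<le> real (Suc n) * T" using cover by blast
    then show "\<exists>x. j x = conv t u \<and> norm x \<le> M' * K * exp t"
      by (rule blocks[OF t]) (use u in auto)
  qed
  then show ?thesis ..
qed

end

section \<open>The perturbed semigroup\<close>

locale perturbed_system = control_system S lam j Am1 Sm1 B
  for S :: "real \<Rightarrow> 'x::complex_banach \<Rightarrow> 'x"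
    and lam :: complex
    and j :: "'x \<Rightarrow> 'y::complex_banach"
    and Am1 :: "'x \<Rightarrow> 'y"
    and Sm1 :: "real \<Rightarrow> 'y \<Rightarrow> 'y"
    and B :: "'x \<Rightarrow> 'y" +
  fixes M \<rho> :: real
  assumes weighted_bound: "weighted_bound M"
    and \<rho>: "0 \<le> \<rho>" "\<rho> * M < 1"
begin

lemma M_nonneg: "0 \<le> M"
  and lift: "0 \<le> t \<Longrightarrow> continuous_on {0..t} u \<Longrightarrow>
    (\<And>s. 0 \<le> s \<Longrightarrow> s \<le> t \<Longrightarrow> norm (u s) \<le> K * exp s) \<Longrightarrow>
    \<exists>x. j x = conv t u \<and> norm x \<le> M * K * exp t"
  using weighted_bound by (simp_all add: weighted_bound_def)

text \<open>The input-to-state map regarded as a map into X itself.\<close>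

definition phi :: "real \<Rightarrow> (real \<Rightarrow> 'x) \<Rightarrow> 'x"
  where "phi t u = (THE x. j x = conv t u)"

lemma phi_eqI: "j x = conv t u \<Longrightarrow> phi t u = x"
  unfolding phi_def by (rule the_equality) (simp_all flip: inj_j)

lemma norm_phi:
  assumes "0 \<le> t" "continuous_on {0..t} u" "\<And>s. 0 \<le> s \<Longrightarrow> s \<le> t \<Longrightarrow> norm (u s) \<le> K * exp s"
  shows "norm (phi t u) \<le> M * K * exp t"
  using lift[OF assms] phi_eqI by blast

lemma j_phi:
  assumes t: "0 \<le> t" and u: "continuous_on {0..t} u"
  shows "j (phi t u) = conv t u"
proof -
  have "bounded (u ` {0..t})"
    by (intro compact_imp_bounded compact_continuous_image u) auto
  then obtain K where K: "0 < K" "\<And>s. 0 \<le> s \<Longrightarrow> s \<le> t \<Longrightarrow> norm (u s) \<le> K"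
    by (auto simp: bounded_pos)
  have "norm (u s) \<le> K * exp s" if "0 \<le> s" "s \<le> t" for s
    using K(2)[OF that] le_mult_exp[of K s] K(1) that by linarith
  then obtain x where "j x = conv t u" using lift[OF t u] by blast
  with phi_eqI show ?thesis by simp
qed

lemma phi_zero [simp]: "phi 0 u = 0"
  by (rule phi_eqI) (simp add: conv_def linear_0[OF bounded_linear.linear[OF j_linear]])

lemma phi_add_scale:
  assumes "0 \<le> t" "continuous_on {0..t} u" "continuous_on {0..t} v"
  shows "phi t (\<lambda>s. u s + a *\<^sub>C v s) = phi t u + a *\<^sub>C phi t v"
  by (rule phi_eqI) (simp add: conv_add_scale assms j_phi bounded_clinearD(2)[OF j_clinear]
      linear_add[OF bounded_linear.linear[OF j_linear]])

lemma phi_diff: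
  assumes "0 \<le> t" "continuous_on {0..t} u" "continuous_on {0..t} v"
  shows "phi t (\<lambda>s. u s - v s) = phi t u - phi t v"
  using phi_add_scale[OF assms, of "- 1"] by simp

lemma phi_shift:
  assumes u: "continuous_on {0..t + s} u" and t: "0 \<le> t" "0 \<le> s"
  shows "phi (t + s) u = S t (phi s u) + phi t (\<lambda>r. u (s + r))"
proof (rule phi_eqI)
  have "continuous_on {0..s} u" using t by (intro continuous_on_subset[OF u]) auto
  moreover have "continuous_on {0..t} (\<lambda>r. u (s + r))"
    using t by (intro continuous_on_compose2[OF u]) (auto intro!: continuous_intros)
  ultimately show "j (S t (phi s u) + phi t (\<lambda>r. u (s + r))) = conv (t + s) u"
    using t by (simp add: linear_add[OF bounded_linear.linear[OF j_linear]] j_phi conv_shift[OF u t]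
        flip: Sm1_j)
qed

text \<open>The values lie continuously in X, not only in the extrapolation space: the increment
  over a time \<open>h\<close> is the effect of \<open>u\<close> minus its delayed copy, which
  is uniformly small, plus the increment of the effect of a constant input.\<close>

lemma phi_continuous:
  assumes u: "continuous_on {0..} u"
  shows "continuous_on {0..} (\<lambda>t. phi t u)"
proof (rule continuous_on_halflineI)
  fix N :: real
  have uN: "continuous_on {0..t} u" for t by (rule continuous_on_subset[OF u]) auto
  obtain c where c: "continuous_on {0..} c" "c 0 = 0"
    "\<And>t. 0 \<le> t \<Longrightarrow> j (c t) = integral {0..t} (\<lambda>s. Sm1 s (B (u 0)))"
    "\<And>t. 0 \<le> t \<Longrightarrow> norm (c t) \<le> (cmod lam * t * exp t + 2) * norm (B (u 0))"
    by (rule orbit_integral_regular[of "B (u 0)"]) (rule that)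
  have inc: "phi (t + h) u - phi t u = phi (t + h) (\<lambda>r. u r - u (max 0 (r - h))) + (c (t + h) - c t)"
    if th: "0 \<le> t" "0 \<le> h" for t h
  proof -
    have v: "continuous_on {0..t + h} (\<lambda>r. u (max 0 (r - h)))"
      using th by (intro continuous_on_compose2[OF uN[of t]]) (auto intro!: continuous_intros)
    have "phi (t + h) (\<lambda>r. u (max 0 (r - h))) = phi t u + (c (t + h) - c t)"
      using th by (intro phi_eqI) (simp add: conv_delay[OF uN th c(3)] j_phi uN
          linear_add[OF bounded_linear.linear[OF j_linear]])
    then show ?thesis
      using th by (simp add: phi_diff[OF _ uN v])
  qed
  have "uniformly_continuous_on {0..N} u" "uniformly_continuous_on {0..N} c"
    by (intro compact_uniformly_continuous uN continuous_on_subset[OF c(1)]; auto)+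
  note uc = this[unfolded uniformly_continuous_on_def, rule_format]
  show "continuous_on {0..N} (\<lambda>t. phi t u)"
  proof (rule uniformly_continuous_imp_continuous, unfold uniformly_continuous_on_def, intro allI impI)
    fix e :: real assume e: "0 < e"
    define a where "a = M + 1"
    have a: "0 < a" using M_nonneg by (simp add: a_def)
    define k where "k = e / 2 / a / exp N"
    have k: "0 < k" "M * k * exp N < e / 2"
    proof -
      show "0 < k" using e a by (simp add: k_def)
      have "a * (k * exp N) = e / 2" using a by (simp add: k_def)
      moreover have "0 < k * exp N" using \<open>0 < k\<close> by simp
      ultimately show "M * k * exp N < e / 2" by (simp add: a_def algebra_simps)
    qed
    obtain d1 where d1: "0 < d1" "\<And>r s. r \<in> {0..N} \<Longrightarrow> s \<in> {0..N} \<Longrightarrow> dist s r < d1 \<Longrightarrow> dist (u s) (u r) < k"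
      using uc(1)[OF k(1)] by blast
    obtain d2 where d2: "0 < d2" "\<And>r s. r \<in> {0..N} \<Longrightarrow> s \<in> {0..N} \<Longrightarrow> dist s r < d2 \<Longrightarrow> dist (c s) (c r) < e / 2"
      using uc(2)[of "e / 2"] e by auto
    have main: "dist (phi t' u) (phi t u) < e" if t: "0 \<le> t" "t \<le> t'" "t' \<le> N" "t' - t < min d1 d2" for t t'
    proof -
      define h where "h = t' - t"
      have h: "0 \<le> h" "t' = t + h" "h < d1" "h < d2" using t by (auto simp: h_def)
      have "norm (phi t' (\<lambda>r. u r - u (max 0 (r - h)))) \<le> M * k * exp t'"
      proof (rule norm_phi)
        show "continuous_on {0..t'} (\<lambda>r. u r - u (max 0 (r - h)))"
          using h t by (intro continuous_on_diff uN continuous_on_compose2[OF uN[of t]]) (auto intro!: continuous_intros)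
        fix s assume s: "0 \<le> s" "s \<le> t'"
        have "norm (u s - u (max 0 (s - h))) < k"
          using d1(2)[of "max 0 (s - h)" s] s h t by (auto simp: dist_norm)
        also have "k \<le> k * exp s" using k(1) s(1) by (intro le_mult_exp) auto
        finally show "norm (u s - u (max 0 (s - h))) \<le> k * exp s" by simp
      qed (use t in auto)
      also have "\<dots> \<le> M * k * exp N" using t M_nonneg k(1) by (intro mult_left_mono) auto
      finally have 1: "norm (phi t' (\<lambda>r. u r - u (max 0 (r - h)))) < e / 2" using k(2) by linarith
      have 2: "norm (c t' - c t) < e / 2"
        using d2(2)[of t t'] t by (auto simp: dist_norm)
      have "dist (phi t' u) (phi t u) \<le> norm (phi t' (\<lambda>r. u r - u (max 0 (r - h)))) + norm (c t' - c t)"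
        unfolding dist_norm h(2) inc[OF t(1) h(1)] by (rule norm_triangle_ineq)
      then show ?thesis using 1 2 by linarith
    qed
    show "\<exists>d>0. \<forall>t\<in>{0..N}. \<forall>t'\<in>{0..N}. dist t' t < d \<longrightarrow> dist (phi t' u) (phi t u) < e"
    proof (intro exI[of _ "min d1 d2"] conjI ballI impI)
      show "0 < min d1 d2" using d1 d2 by simp
      fix t t' assume t: "t \<in> {0..N}" "t' \<in> {0..N}" "dist t' t < min d1 d2"
      show "dist (phi t' u) (phi t u) < e"
      proof (cases "t \<le> t'")
        case True
        then show ?thesis using main[of t t'] t by (auto simp: dist_real_def)
      next
        case False
        then show ?thesis using main[of t' t] t by (auto simp: dist_real_def dist_commute)
      qed
    qed
  qed
qed

text \<open>At a maximum point \<open>s0\<close> of \<open>norm (x s) * exp (- s)\<close> the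
  equation bounds the maximum \<open>K\<close> by \<open>G + \<rho> M K\<close>. The case
  \<open>G = 0\<close> is uniqueness of mild solutions.\<close>

lemma volterra_bound:
  assumes x: "continuous_on {0..\<tau>} x"
    and eq: "\<And>t. 0 \<le> t \<Longrightarrow> t \<le> \<tau> \<Longrightarrow> x t = g t - \<rho> *\<^sub>R phi t x"
    and g: "\<And>t. 0 \<le> t \<Longrightarrow> t \<le> \<tau> \<Longrightarrow> norm (g t) \<le> G * exp t"
    and t: "0 \<le> t" "t \<le> \<tau>"
  shows "norm (x t) \<le> G / (1 - \<rho> * M) * exp t"
proof -
  have "\<exists>s0\<in>{0..\<tau>}. \<forall>s\<in>{0..\<tau>}. norm (x s) * exp (- s) \<le> norm (x s0) * exp (- s0)"
  proof (rule continuous_attains_sup)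
    show "continuous_on {0..\<tau>} (\<lambda>s. norm (x s) * exp (- s))"
      by (intro continuous_intros x)
  qed (use t in auto)
  then obtain s0 where s0: "s0 \<in> {0..\<tau>}"
    "\<And>s. s \<in> {0..\<tau>} \<Longrightarrow> norm (x s) * exp (- s) \<le> norm (x s0) * exp (- s0)"
    by blast
  define K where "K = norm (x s0) * exp (- s0)"
  have K: "norm (x s) \<le> K * exp s" if "0 \<le> s" "s \<le> \<tau>" for s
  proof -
    have "norm (x s) = (norm (x s) * exp (- s)) * exp s" by (simp add: exp_minus)
    also have "\<dots> \<le> K * exp s"
      unfolding K_def using that by (intro mult_right_mono s0(2)) auto
    finally show ?thesis .
  qed
  have "norm (phi s0 x) \<le> M * K * exp s0"
    using s0(1) by (intro norm_phi continuous_on_subset[OF x] K) auto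
  then have phi: "norm (\<rho> *\<^sub>R phi s0 x) \<le> \<rho> * (M * K * exp s0)"
    using \<rho>(1) by (simp add: mult_left_mono)
  have "K * exp s0 = norm (g s0 - \<rho> *\<^sub>R phi s0 x)"
    using eq[of s0] s0(1) by (simp add: K_def exp_minus)
  also have "\<dots> \<le> G * exp s0 + \<rho> * (M * K * exp s0)"
    using s0(1) by (intro order_trans[OF norm_triangle_ineq4 add_mono[OF g phi]]) auto
  also have "\<dots> = (G + \<rho> * M * K) * exp s0" by (simp add: algebra_simps)
  finally have "K \<le> G + \<rho> * M * K" by simp
  then have "K * (1 - \<rho> * M) \<le> G" by (simp add: algebra_simps)
  then have "K \<le> G / (1 - \<rho> * M)"
    using \<rho>(2) by (simp add: pos_le_divide_eq)
  then have "K * exp t \<le> G / (1 - \<rho> * M) * exp t"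
    by (rule mult_right_mono) simp
  then show ?thesis using K[OF t] by linarith
qed

lemma mild_unique:
  assumes x: "continuous_on {0..\<tau>} x" "\<And>t. 0 \<le> t \<Longrightarrow> t \<le> \<tau> \<Longrightarrow> x t = S t x0 - \<rho> *\<^sub>R phi t x"
    and y: "continuous_on {0..\<tau>} y" "\<And>t. 0 \<le> t \<Longrightarrow> t \<le> \<tau> \<Longrightarrow> y t = S t x0 - \<rho> *\<^sub>R phi t y"
    and t: "0 \<le> t" "t \<le> \<tau>"
  shows "x t = y t"
proof -
  have "norm (x t - y t) \<le> 0 / (1 - \<rho> * M) * exp t"
  proof (rule volterra_bound[where g = "\<lambda>t. 0" and \<tau> = \<tau>])
    show "continuous_on {0..\<tau>} (\<lambda>t. x t - y t)" by (intro continuous_intros x y)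
    fix t assume t: "0 \<le> t" "t \<le> \<tau>"
    have "phi t (\<lambda>s. x s - y s) = phi t x - phi t y"
      using t by (intro phi_diff continuous_on_subset[OF x(1)] continuous_on_subset[OF y(1)]) auto
    then show "x t - y t = 0 - \<rho> *\<^sub>R phi t (\<lambda>s. x s - y s)"
      using x(2)[OF t] y(2)[OF t] by (simp add: scaleR_diff_right)
  qed (use t in auto)
  then show ?thesis by simp
qed

text \<open>Banach's fixed point theorem for the weighted unknown \<open>w t = exp (- t) x
  t\<close> in the bounded continuous functions on the real line; \<open>max 0 t\<close> extends
  the equation to negative times.\<close>

lemma mild_exists: "\<exists>x. continuous_on {0..} x \<and> (\<forall>t\<ge>0. x t = S t x0 - \<rho> *\<^sub>R phi t x)"
proof -
  define P where "P w t = exp (- max 0 t) *\<^sub>R (S (max 0 t) x0 - \<rho> *\<^sub>R phi (max 0 t) (\<lambda>s. exp s *\<^sub>R apply_bcontfun w s))"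
    for w :: "real \<Rightarrow>\<^sub>C 'x" and t
  have cw: "continuous_on D (\<lambda>s. exp s *\<^sub>R apply_bcontfun w s)" for D and w :: "real \<Rightarrow>\<^sub>C 'x"
    by (intro continuous_intros continuous_on_apply_bcontfun)
  have P: "P w \<in> bcontfun" for w
  proof (rule bcontfun_normI)
    have "continuous_on UNIV (\<lambda>t. S (max 0 t) x0)"
      by (rule continuous_on_compose2[OF X.continuous_orbit[of "{0..}"]]) (auto intro!: continuous_intros)
    moreover have "continuous_on UNIV (\<lambda>t. phi (max 0 t) (\<lambda>s. exp s *\<^sub>R w s))"
      by (rule continuous_on_compose2[OF phi_continuous[OF cw]]) (auto intro!: continuous_intros)
    ultimately show "continuous_on UNIV (P w)" unfolding P_def[abs_def]
      by (intro continuous_intros)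
    fix t :: real
    let ?t = "max 0 t"
    have "norm (phi ?t (\<lambda>s. exp s *\<^sub>R w s)) \<le> M * norm w * exp ?t"
      using norm_bounded[of w] by (intro norm_phi cw) auto
    then have "norm (S ?t x0 - \<rho> *\<^sub>R phi ?t (\<lambda>s. exp s *\<^sub>R w s)) \<le> norm x0 * exp ?t + \<rho> * (M * norm w * exp ?t)"
      using norm_triangle_ineq4[of "S ?t x0" "\<rho> *\<^sub>R phi ?t (\<lambda>s. exp s *\<^sub>R w s)"] contr[of ?t x0]
        le_mult_exp[of "norm x0" ?t] \<rho>(1)
        mult_left_mono[of "norm (phi ?t (\<lambda>s. exp s *\<^sub>R w s))" "M * norm w * exp ?t" \<rho>] by auto
    also have "\<dots> = exp ?t * (norm x0 + \<rho> * (M * norm w))" by (simp add: algebra_simps)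
    finally have "exp (- ?t) * norm (S ?t x0 - \<rho> *\<^sub>R phi ?t (\<lambda>s. exp s *\<^sub>R w s))
        \<le> exp (- ?t) * (exp ?t * (norm x0 + \<rho> * (M * norm w)))"
      by (rule mult_left_mono) simp
    also have "\<dots> = norm x0 + \<rho> * (M * norm w)" by (simp add: mult.assoc[symmetric] flip: exp_add)
    finally show "norm (P w t) \<le> norm x0 + \<rho> * (M * norm w)" by (simp add: P_def)
  qed
  have "\<exists>!w. Bcontfun (P w) = w"
  proof (rule banach_fix_type)
    show "0 \<le> \<rho> * M" "\<rho> * M < 1" using \<rho> M_nonneg by auto
    show "\<forall>v w. dist (Bcontfun (P v)) (Bcontfun (P w)) \<le> \<rho> * M * dist v w"
    proof (intro allI dist_bound)
      fix v w :: "real \<Rightarrow>\<^sub>C 'x" and t :: real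
      let ?t = "max 0 t"
      let ?v = "\<lambda>s. exp s *\<^sub>R apply_bcontfun v s" and ?w = "\<lambda>s. exp s *\<^sub>R apply_bcontfun w s"
      have "norm (phi ?t (\<lambda>s. ?w s - ?v s)) \<le> M * dist v w * exp ?t"
      proof (rule norm_phi)
        fix s
        have "norm (?w s - ?v s) = exp s * dist (w s) (v s)"
          by (simp add: dist_norm flip: scaleR_diff_right)
        also have "\<dots> \<le> exp s * dist v w" using dist_bounded[of w s v] by (simp add: dist_commute)
        finally show "norm (?w s - ?v s) \<le> dist v w * exp s" by (simp add: mult.commute)
      qed (auto intro!: continuous_on_diff cw)
      then have "exp (- ?t) * (\<rho> * norm (phi ?t (\<lambda>s. ?w s - ?v s))) \<le> exp (- ?t) * (\<rho> * (M * dist v w * exp ?t))"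
        by (intro mult_left_mono \<rho>(1)) auto
      also have "\<dots> = \<rho> * M * dist v w" by (simp add: exp_minus)
      finally have "exp (- ?t) * (\<rho> * norm (phi ?t (\<lambda>s. ?w s - ?v s))) \<le> \<rho> * M * dist v w" .
      moreover have "P v t - P w t = exp (- ?t) *\<^sub>R (\<rho> *\<^sub>R phi ?t (\<lambda>s. ?w s - ?v s))"
        unfolding P_def by (simp add: phi_diff[OF _ cw cw] algebra_simps)
      ultimately show "dist (Bcontfun (P v) t) (Bcontfun (P w) t) \<le> \<rho> * M * dist v w"
        using \<rho>(1) by (simp add: Bcontfun_inverse[OF P] dist_norm)
    qed
  qed
  then obtain w where "Bcontfun (P w) = w" by blast
  then have w: "apply_bcontfun w = P w" using Bcontfun_inverse[OF P[of w]] by metis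
  have "exp t *\<^sub>R w t = S t x0 - \<rho> *\<^sub>R phi t (\<lambda>s. exp s *\<^sub>R w s)" if "0 \<le> t" for t
  proof -
    have "exp t *\<^sub>R w t = exp t *\<^sub>R P w t" by (simp only: fun_cong[OF w, of t])
    also have "\<dots> = S t x0 - \<rho> *\<^sub>R phi t (\<lambda>s. exp s *\<^sub>R w s)"
      using that by (simp add: P_def max_absorb2 exp_minus)
    finally show ?thesis .
  qed
  then show ?thesis
    by (intro exI[of _ "\<lambda>s. exp s *\<^sub>R apply_bcontfun w s"]) (simp add: cw)
qed

definition V :: "real \<Rightarrow> 'x \<Rightarrow> 'x"
  where "V t x0 = (SOME x. continuous_on {0..} x \<and> (\<forall>t\<ge>0. x t = S t x0 - \<rho> *\<^sub>R phi t x)) t"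

lemma V_continuous: "continuous_on {0..} (\<lambda>t. V t x0)"
  and V_mild: "0 \<le> t \<Longrightarrow> V t x0 = S t x0 - \<rho> *\<^sub>R phi t (\<lambda>s. V s x0)"
  using someI_ex[OF mild_exists[of x0]] by (simp_all add: V_def)

lemma V_continuous_Icc: "continuous_on {0..t} (\<lambda>t. V t x0)"
  by (rule continuous_on_subset[OF V_continuous]) auto

lemma V_unique:
  assumes "continuous_on {0..t} x" "\<And>s. 0 \<le> s \<Longrightarrow> s \<le> t \<Longrightarrow> x s = S s x0 - \<rho> *\<^sub>R phi s x" "0 \<le> t"
  shows "V t x0 = x t"
  using assms by (intro mild_unique[of t "\<lambda>t. V t x0" x0 x] V_continuous_Icc V_mild) auto

lemma V_bound:
  assumes "0 \<le> t"
  shows "norm (V t x0) \<le> 1 / (1 - \<rho> * M) * exp t * norm x0"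
proof -
  have "norm (V t x0) \<le> norm x0 / (1 - \<rho> * M) * exp t"
  proof (rule volterra_bound[where g = "\<lambda>t. S t x0" and \<tau> = t])
    show "norm (S t x0) \<le> norm x0 * exp t" if "0 \<le> t" for t
      using X.growth[OF that, of x0] by (simp add: mult.commute)
  qed (use assms in \<open>auto intro: V_continuous_Icc V_mild\<close>)
  then show ?thesis by (simp add: mult_ac)
qed

lemma V_add_scale:
  assumes t: "0 \<le> t"
  shows "V t (x + a *\<^sub>C y) = V t x + a *\<^sub>C V t y"
proof (rule V_unique)
  show "continuous_on {0..t} (\<lambda>t. V t x + a *\<^sub>C V t y)"
    by (intro continuous_on_add V_continuous_Icc bounded_linear.continuous_on[OF bounded_linear_scaleC])
  fix s assume s: "0 \<le> s" "s \<le> t"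
  have "\<rho> *\<^sub>R (a *\<^sub>C z) = a *\<^sub>C (\<rho> *\<^sub>R z)" for z :: 'x
    by (simp add: linear_scale[OF bounded_linear.linear[OF bounded_linear_scaleC]])
  then show "V s x + a *\<^sub>C V s y = S s (x + a *\<^sub>C y) - \<rho> *\<^sub>R phi s (\<lambda>t. V t x + a *\<^sub>C V t y)"
    using s
    by (simp add: phi_add_scale V_continuous_Icc V_mild[of s x] V_mild[of s y]
        linear_add[OF bounded_linear.linear[OF X.semigroup_linear]]
        bounded_clinearD(2)[OF X.semigroup_clinear]
        linear_diff[OF bounded_linear.linear[OF bounded_linear_scaleC]] scaleR_add_right)
qed (rule t)

text \<open>Restarting the mild solution at time \<open>t\<close> gives a solution of the same
  equation, by \<open>phi_shift\<close>.\<close>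

lemma V_shift:
  assumes "0 \<le> s" "0 \<le> t"
  shows "V (s + t) x = V s (V t x)"
proof -
  have "V s (V t x) = V (t + s) x"
  proof (rule V_unique)
    show "continuous_on {0..s} (\<lambda>r. V (t + r) x)"
      using assms by (intro continuous_on_compose2[OF V_continuous]) (auto intro!: continuous_intros)
    fix r assume r: "0 \<le> r" "r \<le> s"
    have "V (r + t) x = S r (S t x) - \<rho> *\<^sub>R (S r (phi t (\<lambda>s. V s x)) + phi r (\<lambda>s. V (t + s) x))"
      using r assms V_continuous_Icc by (simp add: V_mild[of "r + t"] X.semigroup_add phi_shift)
    also have "\<dots> = S r (V t x) - \<rho> *\<^sub>R phi r (\<lambda>s. V (t + s) x)"
      using r assms by (simp add: V_mild[of t] X.semigroup_diff scaleR_add_right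
          linear_scale[OF bounded_linear.linear[OF X.semigroup_linear]])
    finally show "V (t + r) x = S r (V t x) - \<rho> *\<^sub>R phi r (\<lambda>r. V (t + r) x)"
      by (simp add: add.commute)
  qed (use assms in auto)
  then show ?thesis by (simp add: add.commute)
qed

lemma V_growth_semigroup: "growth_semigroup V (1 / (1 - \<rho> * M))"
proof
  show "0 \<le> 1 / (1 - \<rho> * M)" using \<rho>(2) by simp
  show "norm (V t x) \<le> 1 / (1 - \<rho> * M) * exp t * norm x" if "0 \<le> t" for t x
    by (rule V_bound[OF that])
  show "C0_semigroup V"
    unfolding C0_semigroup_def
  proof (intro conjI allI impI)
    show V0: "V 0 = id" using V_mild[of 0] by (simp add: fun_eq_iff)
    show "V (s + t) = V s \<circ> V t" if "0 \<le> s" "0 \<le> t" for s t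
      using V_shift[OF that] by (simp add: fun_eq_iff)
    show "((\<lambda>t. V t x) \<longlongrightarrow> x) (at_right 0)" for x
    proof -
      have "((\<lambda>t. V t x) \<longlongrightarrow> V 0 x) (at 0 within {0..})"
        using V_continuous[of x] by (auto simp: continuous_on_def)
      then show ?thesis by (simp add: at_within_Ici_at_right V0)
    qed
    show "bounded_clinear (V t)" if t: "0 \<le> t" for t
      unfolding bounded_clinear_def
    proof (intro conjI allI)
      have z: "V t 0 = 0" using V_bound[OF t, of 0] by simp
      show sc: "V t (a *\<^sub>C x) = a *\<^sub>C V t x" for a x
        using V_add_scale[OF t, of 0 a x] z by simp
      show "bounded_linear (V t)"
      proof (rule bounded_linear_intro)
        show "V t (x + y) = V t x + V t y" for x y
          using V_add_scale[OF t, of x 1 y] by simp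
        show "V t (r *\<^sub>R x) = r *\<^sub>R V t x" for r x
          using sc[of "complex_of_real r" x] by (simp add: scaleC_of_real)
        show "norm (V t x) \<le> norm x * (1 / (1 - \<rho> * M) * exp t)" for x
          using V_bound[OF t, of x] by (simp add: mult_ac)
      qed
    qed
  qed
qed

sublocale V: growth_semigroup V "1 / (1 - \<rho> * M)"
  by (rule V_growth_semigroup)

text \<open>The perturbed and the free orbit differ by \<open>\<rho>\<close> times the effect of
  the feedback input, hence by \<open>O(\<rho>)\<close> uniformly on bounded time
  intervals.\<close>

lemma V_minus_S:
  assumes t: "0 \<le> t"
  shows "norm (V t x - S t x) \<le> \<rho> * M / (1 - \<rho> * M) * exp t * norm x"
proof -
  have "norm (phi t (\<lambda>s. V s x)) \<le> M * (1 / (1 - \<rho> * M) * norm x) * exp t"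
    using V_bound by (intro norm_phi[OF t V_continuous_Icc]) (simp add: mult_ac)
  from mult_left_mono[OF this \<rho>(1)] show ?thesis
    using \<rho>(1) by (simp add: V_mild[OF t, of x] mult_ac)
qed

text \<open>Differentiate the mild formula at time 0 in the extrapolation space, where every
  orbit starting in X is differentiable.\<close>

lemma generator_subset_part:
  assumes "(x, y) \<in> generator V"
  shows "Am1 x - \<rho> *\<^sub>R B x = j y"
proof -
  have 1: "((\<lambda>h. j ((V h x - x) /\<^sub>R h)) \<longlongrightarrow> j y) (at_right 0)"
    using assms by (intro bounded_linear.tendsto[OF j_linear]) (simp add: generator_def)
  have 2: "((\<lambda>h. (Sm1 h (j x) - j x) /\<^sub>R h - \<rho> *\<^sub>R (conv h (\<lambda>s. V s x) /\<^sub>R h))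
      \<longlongrightarrow> Am1 x - \<rho> *\<^sub>R B (V 0 x)) (at_right 0)"
    using extrapolated_generator[of x]
    by (intro tendsto_intros conv_average_tendsto V_continuous) (simp add: generator_def)
  have "(Sm1 h (j x) - j x) /\<^sub>R h - \<rho> *\<^sub>R (conv h (\<lambda>s. V s x) /\<^sub>R h) = j ((V h x - x) /\<^sub>R h)"
    if h: "0 < h" for h
  proof -
    have "j (V h x - x) = Sm1 h (j x) - \<rho> *\<^sub>R conv h (\<lambda>s. V s x) - j x"
      using h by (simp add: V_mild[of h x] linear_diff[OF bounded_linear.linear[OF j_linear]]
          linear_scale[OF bounded_linear.linear[OF j_linear]] j_phi V_continuous_Icc Sm1_j)
    then have "j ((V h x - x) /\<^sub>R h) = (Sm1 h (j x) - \<rho> *\<^sub>R conv h (\<lambda>s. V s x) - j x) /\<^sub>R h"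
      by (simp only: linear_scale[OF bounded_linear.linear[OF j_linear]])
    then show ?thesis
      by (simp add: scaleR_diff_right mult.commute)
  qed
  then have ev: "\<forall>\<^sub>F h in at_right 0. (Sm1 h (j x) - j x) /\<^sub>R h - \<rho> *\<^sub>R (conv h (\<lambda>s. V s x) /\<^sub>R h) = j ((V h x - x) /\<^sub>R h)"
    by (rule eventually_at_right_zeroI)
  have "Am1 x - \<rho> *\<^sub>R B (V 0 x) = j y"
    by (rule tendsto_unique[OF _ Lim_transform_eventually[OF 2 ev] 1]) simp
  then show ?thesis by simp
qed

text \<open>Given \<open>A x - \<rho> B x = y\<close> in X, the curve \<open>z s = x +
  \<integral> V r y\<close> over \<open>[0, s]\<close> solves \<open>z' = A z - \<rho> B
  z\<close> classically in the extrapolation space. By the product rule it satisfies the mild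
  equation, so \<open>z s = V s x\<close> by uniqueness, and differentiating at 0 in X puts
  \<open>(x, y)\<close> in the generator.\<close>

lemma part_subset_generator:
  assumes xy: "Am1 x - \<rho> *\<^sub>R B x = j y"
  shows "(x, y) \<in> generator V"
proof -
  define z where "z s = x + integral {0..s} (\<lambda>r. V r y)" for s
  have zd: "(z has_vector_derivative V s y) (at s within {0..})" if "0 \<le> s" for s
    unfolding z_def using that
    by (auto intro!: derivative_eq_intros integral_has_vector_derivative_halfline V_continuous)
  have zc: "continuous_on {0..s} z" for s
  proof (rule continuous_on_subset)
    show "continuous_on {0..} z"
      unfolding continuous_on_eq_continuous_within
      using has_vector_derivative_continuous[OF zd] by simp
  qed auto
  have zA: "Am1 (z s) - \<rho> *\<^sub>R B (z s) = j (V s y)" if "0 \<le> s" for s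
    using generator_subset_part[OF V.integral_in_generator[OF that, of y]] xy
    by (simp add: z_def linear_add[OF bounded_linear.linear[OF Am1_linear]]
        linear_add[OF bounded_linear.linear[OF B_linear]] linear_diff[OF bounded_linear.linear[OF j_linear]]
        algebra_simps)
  have mild: "z t = S t x - \<rho> *\<^sub>R phi t z" if t: "0 \<le> t" for t
  proof -
    have "((\<lambda>s. Sm1 s (j (z (t - s)))) has_vector_derivative Sm1 s (\<rho> *\<^sub>R B (z (t - s)))) (at s within {0..t})"
      if s: "s \<in> {0..t}" for s
    proof -
      have 1: "((\<lambda>s. t - s) has_vector_derivative - 1) (at s within {0..t})"
        by (auto intro!: derivative_eq_intros)
      have 2: "(z has_vector_derivative V (t - s) y) (at (t - s) within (\<lambda>s. t - s) ` {0..t})"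
        using s by (intro has_vector_derivative_within_subset[OF zd]) auto
      have "((\<lambda>s. z (t - s)) has_vector_derivative - V (t - s) y) (at s within {0..t})"
        using vector_diff_chain_within[OF 1 2] by (simp add: o_def)
      then have "((\<lambda>s. j (z (t - s))) has_vector_derivative j (- V (t - s) y)) (at s within {0..t})"
        by (rule bounded_linear.has_vector_derivative[OF j_linear])
      then have "((\<lambda>s. Sm1 s (j (z (t - s)))) has_vector_derivative
          Sm1 s (Am1 (z (t - s)) + j (- V (t - s) y))) (at s within {0..t})"
        using s by (intro Y.product_derivative extrapolated_generator) auto
      moreover have "Am1 (z (t - s)) + j (- V (t - s) y) = \<rho> *\<^sub>R B (z (t - s))"
        using zA[of "t - s"] s by (simp add: linear_neg[OF bounded_linear.linear[OF j_linear]] algebra_simps)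
      ultimately show ?thesis by simp
    qed
    then have "((\<lambda>s. Sm1 s (\<rho> *\<^sub>R B (z (t - s)))) has_integral Sm1 t (j (z (t - t))) - Sm1 0 (j (z (t - 0)))) {0..t}"
      by (rule fundamental_theorem_of_calculus[OF t])
    then have "integral {0..t} (\<lambda>s. Sm1 s (\<rho> *\<^sub>R B (z (t - s)))) = Sm1 t (j x) - j (z t)"
      by (simp add: integral_unique z_def)
    moreover have "integral {0..t} (\<lambda>s. Sm1 s (\<rho> *\<^sub>R B (z (t - s)))) = \<rho> *\<^sub>R conv t z"
    proof -
      have "integral {0..t} (\<lambda>s. Sm1 s (\<rho> *\<^sub>R B (z (t - s)))) = integral {0..t} (\<lambda>s. \<rho> *\<^sub>R Sm1 s (B (z (t - s))))"
        by (intro integral_cong) (simp add: linear_scale[OF bounded_linear.linear[OF Sm1_linear]])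
      then show ?thesis by (simp add: conv_def)
    qed
    ultimately have "j (z t) = j (S t x - \<rho> *\<^sub>R phi t z)"
      using t by (simp add: linear_diff[OF bounded_linear.linear[OF j_linear]]
          linear_scale[OF bounded_linear.linear[OF j_linear]] j_phi[OF t zc] Sm1_j algebra_simps)
    then show ?thesis by (simp add: inj_j)
  qed
  have "V t x = z t" if "0 \<le> t" for t
    by (rule V_unique[OF zc mild that])
  then have ev: "\<forall>\<^sub>F h in at_right 0. integral {0..0 + h} (\<lambda>r. V r y) /\<^sub>R h = (V h x - x) /\<^sub>R h"
    by (intro eventually_at_right_zeroI) (simp add: z_def)
  have "((\<lambda>h. integral {0..0 + h} (\<lambda>r. V r y) /\<^sub>R h) \<longlongrightarrow> V 0 y) (at_right 0)"
    by (intro average_tendsto V_continuous) simp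
  from Lim_transform_eventually[OF this ev] show ?thesis
    by (simp add: generator_def)
qed

lemma generator_V: "generator V = part_in j (\<lambda>x. Am1 x - \<rho> *\<^sub>R B x)"
proof (rule set_eqI)
  fix p :: "'x \<times> 'x"
  obtain x y where "p = (x, y)" by (cases p)
  then show "p \<in> generator V \<longleftrightarrow> p \<in> part_in j (\<lambda>x. Am1 x - \<rho> *\<^sub>R B x)"
    using generator_subset_part[of x y] part_subset_generator[of x y] unfolding part_in_def by blast
qed

end

section \<open>Dissipativity and exponential stability\<close>

lemma Re_cinner_self: "Re (cinner x x) = (norm (x::'a::complex_hilbert))\<^sup>2"
proof -
  have "0 \<le> sqrt (Re (cinner x x))"
    using norm_ge_zero[of x] unfolding norm_eq_sqrt_cinner .
  then show ?thesis unfolding norm_eq_sqrt_cinner[of x] by simp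
qed

lemma Re_cinner_commute: "Re (cinner x y) = Re (cinner y (x::'a::complex_hilbert))"
  by (subst cinner_commute) simp

lemma Re_cinner_add_right: "Re (cinner x (y + z)) = Re (cinner x y) + Re (cinner x (z::'a::complex_hilbert))"
  by (simp add: Re_cinner_commute[of x] cinner_add_left)

lemma Re_cinner_scaleR_left: "Re (cinner (r *\<^sub>R x) y) = r * Re (cinner x (y::'a::complex_hilbert))"
  by (simp add: cinner_scaleC_left flip: scaleC_of_real)

text \<open>Cauchy-Schwarz for the real part follows from the triangle inequality by expanding
  \<open>norm (x + y)\<^sup>2\<close>.\<close>

lemma Re_cinner_le: "Re (cinner x y) \<le> norm x * norm (y::'a::complex_hilbert)"
proof -
  have "(norm (x + y))\<^sup>2 = (norm x)\<^sup>2 + 2 * Re (cinner x y) + (norm y)\<^sup>2"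
    using Re_cinner_commute[of y x]
    by (simp add: cinner_add_left Re_cinner_add_right flip: Re_cinner_self)
  moreover have "(norm (x + y))\<^sup>2 \<le> (norm x + norm y)\<^sup>2"
    by (intro power_mono norm_triangle_ineq) simp
  ultimately show ?thesis by (simp add: power2_sum)
qed

lemma bounded_bilinear_Re_cinner: "bounded_bilinear (\<lambda>x y. Re (cinner x (y::'a::complex_hilbert)))"
proof
  fix x y z :: 'a and r :: real
  show "Re (cinner (x + y) z) = Re (cinner x z) + Re (cinner y z)" by (simp add: cinner_add_left)
  show "Re (cinner x (y + z)) = Re (cinner x y) + Re (cinner x z)" by (rule Re_cinner_add_right)
  show "Re (cinner (r *\<^sub>R x) y) = r *\<^sub>R Re (cinner x y)" by (simp add: Re_cinner_scaleR_left)
  show "Re (cinner x (r *\<^sub>R y)) = r *\<^sub>R Re (cinner x y)"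
    by (simp add: Re_cinner_commute[of x] Re_cinner_scaleR_left)
  have "\<bar>Re (cinner x y)\<bar> \<le> norm x * norm y" for x y :: 'a
    using Re_cinner_le[of x y] Re_cinner_le[of "(- 1) *\<^sub>R x" y] Re_cinner_scaleR_left[of "- 1" x y] by simp
  then show "\<exists>K. \<forall>x y::'a. norm (Re (cinner x y)) \<le> norm x * norm y * K"
    by (intro exI[of _ 1]) simp
qed

lemma X_proj_eqI:
  assumes j: "bounded_clinear j" and inj: "inj j"
    and W: "direct_decomposition j W" and z: "z = j a + w" "w \<in> W"
  shows "X_proj j W z = a"
  unfolding X_proj_def
proof (rule the_equality)
  show "\<exists>w\<in>W. z = j a + w" using z by blast
  fix b assume "\<exists>w\<in>W. z = j b + w"
  then obtain v where v: "v \<in> W" "z = j b + v" by blast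
  have sub: "subspace W" using W by (simp add: direct_decomposition_def csubspace_def)
  have lin: "linear j" using j by (simp add: bounded_clinear_def bounded_linear.linear)
  have "j (a - b) = v - w"
    using z(1) v(2) by (simp add: linear_diff[OF lin] algebra_simps)
  moreover have "v - w \<in> W" by (rule subspace_diff[OF sub v(1) z(2)])
  ultimately have "j (a - b) \<in> W" by simp
  then have "j (a - b) \<in> range j \<inter> W" by blast
  moreover have "range j \<inter> W = {0}" using W by (simp add: direct_decomposition_def)
  ultimately have "j (a - b) = 0" by blast
  then have "j (a - b) = j 0" by (simp add: linear_0[OF lin])
  from injD[OF inj this] show "b = a" by simp
qed

text \<open>On the domain of the perturbed generator the sum \<open>A x - \<rho> B x\<close>
  lies in X, so by uniqueness of the decomposition it is the sum of the X-components of its two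
  terms. The first is dissipative by assumption and the second is \<open>- \<rho>\<close> times
  the X-component of \<open>B x\<close>.\<close>

lemma X_comp_dissipative:
  fixes j :: "'x::complex_hilbert \<Rightarrow> 'y::complex_banach"
  assumes j: "bounded_clinear j" and inj: "inj j"
    and W: "direct_decomposition j W"
    and adm: "admissible_decomposition j W Am1 (\<lambda>x. - (\<rho> *\<^sub>R B x))" and \<rho>: "0 < \<rho>"
  shows "bounded_linear (X_comp j W B)"
    and "Am1 x - \<rho> *\<^sub>R B x = j y \<Longrightarrow> Re (cinner y x) \<le> - \<rho> * Re (cinner (X_comp j W B x) x)"
proof -
  let ?L = "\<lambda>x. - (\<rho> *\<^sub>R B x)"
  have lin: "linear j" using j by (simp add: bounded_clinear_def bounded_linear.linear)
  have sub: "subspace W" using W by (simp add: direct_decomposition_def csubspace_def)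
  note proj = X_proj_eqI[OF j inj W]
  have comp: "X_comp j W B x = (- 1 / \<rho>) *\<^sub>R X_comp j W ?L x" for x
  proof -
    have "?L x \<in> sum_space j W" using adm by (auto simp: admissible_decomposition_def)
    then obtain a w where aw: "?L x = j a + w" "w \<in> W" by (auto simp: sum_space_def)
    have "B x = (- 1 / \<rho>) *\<^sub>R ?L x" using \<rho> by simp
    also have "\<dots> = j ((- 1 / \<rho>) *\<^sub>R a) + (- 1 / \<rho>) *\<^sub>R w"
      unfolding aw(1) linear_scale[OF lin] by (rule scaleR_add_right)
    finally have "X_proj j W (B x) = (- 1 / \<rho>) *\<^sub>R a"
      using subspace_scale[OF sub aw(2)] by (rule proj)
    then show ?thesis unfolding X_comp_def proj[OF aw] .
  qed
  have "bounded_linear (X_comp j W ?L)"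
    using adm by (simp add: admissible_decomposition_def bounded_clinear_def)
  then have "bounded_linear (\<lambda>x. (- 1 / \<rho>) *\<^sub>R X_comp j W ?L x)"
    by (rule bounded_linear_const_scaleR)
  then show "bounded_linear (X_comp j W B)"
    unfolding ext[OF comp, symmetric] .
  assume y: "Am1 x - \<rho> *\<^sub>R B x = j y"
  have "Am1 x \<in> sum_space j W" "?L x \<in> sum_space j W"
    using adm by (auto simp: admissible_decomposition_def)
  then obtain a v b w where A: "Am1 x = j a + v" "v \<in> W" and L: "?L x = j b + w" "w \<in> W"
    by (auto simp: sum_space_def)
  have sum: "j y = Am1 x + ?L x" using y by simp
  have "j y = j (a + b) + (v + w)"
    unfolding sum A(1) L(1) linear_add[OF lin] by (simp add: algebra_simps)
  then have "X_proj j W (j y) = a + b"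
    using subspace_add[OF sub A(2) L(2)] by (rule proj)
  moreover have "X_proj j W (j y) = y"
    by (rule proj[OF _ subspace_0[OF sub]]) simp
  ultimately have yab: "y = a + b" by simp
  have "X_comp j W B x = (- 1 / \<rho>) *\<^sub>R b"
    unfolding comp[of x] by (simp add: X_comp_def proj[OF L])
  then have "Re (cinner b x) = - \<rho> * Re (cinner (X_comp j W B x) x)"
    using \<rho> by (simp only: Re_cinner_scaleR_left) simp
  moreover have "Re (cinner a x) \<le> 0"
  proof -
    have "Am1 x + ?L x \<in> range j" unfolding sum[symmetric] by simp
    then have "Re (cinner (X_comp j W Am1 x) x) \<le> 0"
      using adm unfolding admissible_decomposition_def by blast
    then show ?thesis unfolding X_comp_def proj[OF A] .
  qed
  ultimately show "Re (cinner y x) \<le> - \<rho> * Re (cinner (X_comp j W B x) x)"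
    by (simp add: yab cinner_add_left)
qed

text \<open>A strict contraction at one time \<open>T\<close> is iterated; the constant absorbs
  the last incomplete block.\<close>

lemma (in growth_semigroup) exponentially_stableI:
  assumes T: "0 < T" and q: "0 < q" "q < 1" and step: "\<And>x. norm (S T x) \<le> q * norm x"
  shows "exponentially_stable S"
proof -
  define \<sigma> where "\<sigma> = - ln q / T"
  have \<sigma>: "0 < \<sigma>" using q T by (simp add: \<sigma>_def divide_neg_pos)
  have q_exp: "q = exp (- \<sigma> * T)" using q T by (simp add: \<sigma>_def)
  have pow: "norm (S (real n * T) x) \<le> q ^ n * norm x" for n x
  proof (induction n)
    case (Suc n)
    have "S (real (Suc n) * T) x = S T (S (real n * T) x)"
      using semigroup_add[of T "real n * T" x] T by (simp add: algebra_simps)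
    then have "norm (S (real (Suc n) * T) x) \<le> q * norm (S (real n * T) x)" using step by simp
    also have "\<dots> \<le> q * (q ^ n * norm x)" using q Suc by (intro mult_left_mono) auto
    finally show ?case by simp
  qed simp
  have "norm (S t x) \<le> (C * exp T * exp (\<sigma> * T) + 1) * exp (- \<sigma> * t) * norm x" if t: "0 \<le> t" for t x
  proof -
    define n where "n = nat \<lfloor>t / T\<rfloor>"
    define r where "r = t - real n * T"
    have n: "real n \<le> t / T" "t / T < real n + 1"
      using t T unfolding n_def by (simp_all add: of_nat_nat)
    then have r: "0 \<le> r" "r \<le> T" using T by (simp_all add: r_def field_simps)
    have "norm (S t x) = norm (S r (S (real n * T) x))"
      using semigroup_add[of r "real n * T" x] r T by (simp add: r_def)
    also have "\<dots> \<le> C * exp r * norm (S (real n * T) x)" by (rule growth[OF r(1)])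
    also have "\<dots> \<le> C * exp T * (q ^ n * norm x)"
      using r C_nonneg by (intro mult_mono pow) auto
    also have "q ^ n = exp (- \<sigma> * (real n * T))" unfolding q_exp by (simp add: mult_ac flip: exp_of_nat_mult)
    also have "\<dots> \<le> exp (\<sigma> * T) * exp (- \<sigma> * t)"
    proof -
      have "\<sigma> * r \<le> \<sigma> * T" using \<sigma> r by (intro mult_left_mono) auto
      then show ?thesis by (simp add: r_def algebra_simps flip: exp_add)
    qed
    finally have "norm (S t x) \<le> C * exp T * (exp (\<sigma> * T) * exp (- \<sigma> * t) * norm x)"
      using C_nonneg by (simp add: mult_left_mono mult_right_mono)
    also have "\<dots> = C * exp T * exp (\<sigma> * T) * (exp (- \<sigma> * t) * norm x)" by (simp add: mult_ac)
    also have "\<dots> \<le> (C * exp T * exp (\<sigma> * T) + 1) * (exp (- \<sigma> * t) * norm x)"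
      by (intro mult_right_mono) auto
    finally show ?thesis by (simp add: mult_ac)
  qed
  moreover have "0 < C * exp T * exp (\<sigma> * T) + 1" using C_nonneg by (simp add: add_nonneg_pos)
  ultimately show ?thesis unfolding exponentially_stable_def using \<sigma> by blast
qed

text \<open>Integrate the derivative \<open>2 Re \<langle>x', x\<rangle>\<close> of
  \<open>norm\<^sup>2\<close> along a classical solution.\<close>

lemma energy_estimate:
  fixes V :: "real \<Rightarrow> 'x::complex_hilbert \<Rightarrow> 'x"
  assumes "growth_semigroup V C" and Q: "bounded_linear Q"
    and diss: "\<And>x y. (x, y) \<in> generator V \<Longrightarrow> Re (cinner y x) \<le> - \<rho> * Re (cinner (Q x) x)"
    and x: "(x, y) \<in> generator V" and T: "0 \<le> T"
  shows "(norm (V T x))\<^sup>2 \<le> (norm x)\<^sup>2 - 2 * \<rho> * integral {0..T} (\<lambda>t. Re (cinner (Q (V t x)) (V t x)))"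
proof -
  interpret growth_semigroup V C by fact
  let ?v = "\<lambda>t. V t x" and ?f = "\<lambda>t. 2 * Re (cinner (V t y) (V t x))"
    and ?g = "\<lambda>t. - 2 * \<rho> * Re (cinner (Q (V t x)) (V t x))"
  have cont: "continuous_on {0..T} (\<lambda>t. V t z)" for z by (rule continuous_orbit) auto
  have "((\<lambda>t. Re (cinner (V t x) (V t x))) has_vector_derivative ?f t) (at t within {0..T})"
    if t: "t \<in> {0..T}" for t
  proof -
    have d: "(?v has_vector_derivative V t y) (at t within {0..T})"
      using t by (intro has_vector_derivative_within_subset[OF orbit_derivative[OF x]]) auto
    show ?thesis
      using bounded_bilinear.has_vector_derivative[OF bounded_bilinear_Re_cinner d d]
      by (simp add: Re_cinner_commute[of "V t x"])
  qed
  then have I: "(?f has_integral Re (cinner (V T x) (V T x)) - Re (cinner (V 0 x) (V 0 x))) {0..T}"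
    by (rule fundamental_theorem_of_calculus[OF T])
  have cg: "continuous_on {0..T} (\<lambda>t. Re (cinner (Q (V t x)) (V t x)))"
    by (intro bounded_bilinear.continuous_on[OF bounded_bilinear_Re_cinner]
        bounded_linear.continuous_on[OF Q] cont)
  have "(norm (V T x))\<^sup>2 - (norm x)\<^sup>2 = integral {0..T} ?f"
    using integral_unique[OF I] by (simp add: Re_cinner_self)
  also have "\<dots> \<le> integral {0..T} ?g"
  proof (rule integral_le)
    show "?f integrable_on {0..T}" using I by blast
    show "?g integrable_on {0..T}"
      by (intro integrable_continuous_real continuous_intros cg)
    show "?f t \<le> ?g t" if "t \<in> {0..T}" for t
      using diss[OF generator_invariant[OF x, of t]] that by simp
  qed
  also have "\<dots> = - 2 * \<rho> * integral {0..T} (\<lambda>t. Re (cinner (Q (V t x)) (V t x)))" by simp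
  finally show ?thesis by simp
qed

lemma quadratic_form_diff:
  fixes v s :: "'x::complex_hilbert"
  assumes Q: "bounded_linear Q" and close: "norm (v - s) \<le> e" and le: "norm v \<le> a" "norm s \<le> c"
  shows "Re (cinner (Q s) s) - onorm Q * e * (a + c) \<le> Re (cinner (Q v) v)"
proof -
  have e: "0 \<le> e" using close norm_ge_zero order_trans by blast
  have "Re (cinner (Q s) s) - Re (cinner (Q v) v) = Re (cinner (Q (s - v)) v) + Re (cinner (Q s) (s - v))"
  proof -
    have Qd: "Q s = Q (s - v) + Q v"
      using linear_add[OF bounded_linear.linear[OF Q], of "s - v" v] by simp
    have "Re (cinner (Q s) s) = Re (cinner (Q s) ((s - v) + v))" by simp
    also have "\<dots> = Re (cinner (Q s) (s - v)) + Re (cinner (Q s) v)" by (rule Re_cinner_add_right)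
    also have "Re (cinner (Q s) v) = Re (cinner (Q (s - v)) v) + Re (cinner (Q v) v)"
      unfolding Qd[of] by (simp add: cinner_add_left)
    finally show ?thesis by simp
  qed
  also have "\<dots> \<le> (onorm Q * e) * a + (onorm Q * c) * e"
  proof (rule add_mono)
    have n: "norm (Q z) \<le> onorm Q * K" if "norm z \<le> K" for z K
      using that by (intro order_trans[OF onorm[OF Q] mult_left_mono] onorm_pos_le[OF Q])
    have p: "0 \<le> onorm Q * e" "0 \<le> onorm Q * c"
      using onorm_pos_le[OF Q] e order_trans[OF norm_ge_zero le(2)] by auto
    show "Re (cinner (Q (s - v)) v) \<le> (onorm Q * e) * a"
      using close by (intro order_trans[OF Re_cinner_le] mult_mono n le p(1)) (auto simp: norm_minus_commute)
    show "Re (cinner (Q s) (s - v)) \<le> (onorm Q * c) * e"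
      using close by (intro order_trans[OF Re_cinner_le] mult_mono n le p(2)) (auto simp: norm_minus_commute)
  qed
  finally show ?thesis by (simp add: algebra_simps)
qed

text \<open>The energy loss of the perturbed orbit over \<open>[0, T]\<close> is at least
  \<open>2 \<rho>\<close> times the observation integral, whose integrand is within
  \<open>O(\<rho>)\<close> of that of the free orbit; the latter is at least \<open>\<delta>
  norm (S T x)\<^sup>2\<close>, and \<open>S T x\<close> may again be replaced by \<open>V T
  x\<close> up to \<open>O(\<rho>)\<close>. All errors enter the energy balance at order
  \<open>\<rho>\<^sup>2\<close> while the gain \<open>\<rho> \<delta>\<close> is of order
  \<open>\<rho>\<close>, so \<open>(1 + \<rho> \<delta>) norm (V T x)\<^sup>2 \<le> (1 + \<rho>
  \<delta> / 2) norm x\<^sup>2\<close> for small \<open>\<rho>\<close>.\<close>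

lemma stable_of_observability:
  fixes S V :: "real \<Rightarrow> 'x::complex_hilbert \<Rightarrow> 'x"
  assumes S: "contraction_semigroup S" and V: "growth_semigroup V C" and Q: "bounded_linear Q"
    and diss: "\<And>x y. (x, y) \<in> generator V \<Longrightarrow> Re (cinner y x) \<le> - \<rho> * Re (cinner (Q x) x)"
    and close: "\<And>t x. 0 \<le> t \<Longrightarrow> t \<le> T \<Longrightarrow> norm (V t x - S t x) \<le> \<rho> * \<kappa> * norm x"
    and obs: "\<And>x. \<delta> * (norm (S T x))\<^sup>2 \<le> integral {0..T} (\<lambda>t. Re (cinner (Q (S t x)) (S t x)))"
    and pos: "0 < T" "0 < \<delta>" "0 < \<rho>" "0 \<le> \<kappa>" and \<rho>: "\<rho> \<le> 1" "\<rho> * \<kappa> \<le> 1"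
    and small: "\<rho> * (6 * onorm Q * \<kappa> * T + 2 * \<delta> * \<kappa>\<^sup>2) \<le> \<delta> / 2"
  shows "exponentially_stable V"
proof -
  interpret S: growth_semigroup S 1 by (rule growth_semigroup_contraction[OF S])
  interpret V: growth_semigroup V C by fact
  have contr: "norm (S t x) \<le> norm x" if "0 \<le> t" for t x
    using S that by (simp add: contraction_semigroup_def)
  have contQ: "continuous_on {0..T} (\<lambda>t. Re (cinner (Q (U t)) (U t)))" if "continuous_on {0..T} U" for U
    by (intro bounded_bilinear.continuous_on[OF bounded_bilinear_Re_cinner]
        bounded_linear.continuous_on[OF Q] that)
  define r where "r = (1 + \<rho> * \<delta> / 2) / (1 + \<rho> * \<delta>)"
  have \<rho>\<delta>: "0 < \<rho> * \<delta>" using pos by simp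
  have r: "0 < r" "r < 1" using \<rho>\<delta> by (simp_all add: r_def field_simps add_pos_pos)
  \<comment> \<open>The energy balance needs a classical solution; the resulting bound extends
    to all x by density.\<close>
  have dom: "(norm (V T x))\<^sup>2 \<le> r * (norm x)\<^sup>2" if x: "(x, y) \<in> generator V" for x y
  proof -
    define N where "N = norm x"
    define IV where "IV = integral {0..T} (\<lambda>t. Re (cinner (Q (V t x)) (V t x)))"
    define IS where "IS = integral {0..T} (\<lambda>t. Re (cinner (Q (S t x)) (S t x)))"
    have N: "0 \<le> N" by (simp add: N_def)
    have E: "(norm (V T x))\<^sup>2 \<le> N\<^sup>2 - 2 * \<rho> * IV"
      using energy_estimate[OF V Q diss x] pos by (simp add: N_def IV_def)
    have H: "\<delta> * (norm (S T x))\<^sup>2 \<le> IS" unfolding IS_def by (rule obs)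
    let ?c = "onorm Q * (\<rho> * \<kappa> * N) * (2 * N + N)"
    have I: "IS - ?c * T \<le> IV"
    proof -
      have "Re (cinner (Q (S t x)) (S t x)) - ?c \<le> Re (cinner (Q (V t x)) (V t x))" if t: "t \<in> {0..T}" for t
      proof (rule quadratic_form_diff[OF Q])
        show "norm (V t x - S t x) \<le> \<rho> * \<kappa> * N" using close t by (simp add: N_def)
        also have "\<dots> \<le> 1 * N" using \<rho>(2) N by (rule mult_right_mono)
        finally show "norm (V t x) \<le> 2 * N"
          using norm_triangle_ineq[of "V t x - S t x" "S t x"] contr[of t x] t by (simp add: N_def)
        show "norm (S t x) \<le> N" using contr[of t x] t by (simp add: N_def)
      qed
      then have "integral {0..T} (\<lambda>t. Re (cinner (Q (S t x)) (S t x)) - ?c) \<le> IV"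
        unfolding IV_def
        by (intro integral_le integrable_continuous_real continuous_on_diff continuous_on_const contQ
            S.continuous_orbit V.continuous_orbit) auto
      also have "integral {0..T} (\<lambda>t. Re (cinner (Q (S t x)) (S t x)) - ?c)
          = IS - integral {0..T} (\<lambda>t. ?c)"
        unfolding IS_def
        by (intro integral_diff integrable_continuous_real continuous_on_const contQ S.continuous_orbit) auto
      finally show ?thesis using pos by (simp add: algebra_simps)
    qed
    have c: "(norm (V T x))\<^sup>2 \<le> 2 * (norm (S T x))\<^sup>2 + 2 * (\<rho> * \<kappa> * N)\<^sup>2"
    proof -
      have "norm (V T x) \<le> norm (S T x) + \<rho> * \<kappa> * N"
        using norm_triangle_ineq[of "V T x - S T x" "S T x"] close[of T x] pos by (simp add: N_def)
      then have "(norm (V T x))\<^sup>2 \<le> (norm (S T x) + \<rho> * \<kappa> * N)\<^sup>2" by (intro power_mono) auto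
      also have "\<dots> \<le> 2 * (norm (S T x))\<^sup>2 + 2 * (\<rho> * \<kappa> * N)\<^sup>2"
        using sum_squares_bound[of "norm (S T x)" "\<rho> * \<kappa> * N"] by (simp add: power2_sum)
      finally show ?thesis .
    qed
    have "\<rho> * \<delta> * (norm (V T x))\<^sup>2 \<le> \<rho> * \<delta> * (2 * (norm (S T x))\<^sup>2 + 2 * (\<rho> * \<kappa> * N)\<^sup>2)"
      using \<rho>\<delta> by (intro mult_left_mono c) auto
    moreover have "2 * \<rho> * (\<delta> * (norm (S T x))\<^sup>2 - ?c * T) \<le> 2 * \<rho> * IV"
      using H I pos by (intro mult_left_mono) auto
    ultimately have "(1 + \<rho> * \<delta>) * (norm (V T x))\<^sup>2
        \<le> N\<^sup>2 + 2 * \<rho> * (?c * T) + \<rho> * \<delta> * (2 * (\<rho> * \<kappa> * N)\<^sup>2)"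
      using E by (simp add: algebra_simps)
    also have "\<dots> = N\<^sup>2 + N\<^sup>2 * \<rho> * (\<rho> * (6 * onorm Q * \<kappa> * T + \<rho> * (2 * \<delta> * \<kappa>\<^sup>2)))"
      by (simp add: power2_eq_square algebra_simps)
    also have "\<dots> \<le> N\<^sup>2 + N\<^sup>2 * \<rho> * (\<rho> * (6 * onorm Q * \<kappa> * T + 1 * (2 * \<delta> * \<kappa>\<^sup>2)))"
      using pos \<rho> by (intro add_left_mono mult_left_mono mult_right_mono) auto
    also have "\<dots> \<le> N\<^sup>2 + N\<^sup>2 * \<rho> * (\<delta> / 2)"
      using small pos by (intro add_left_mono mult_left_mono) auto
    finally have "(1 + \<rho> * \<delta>) * (norm (V T x))\<^sup>2 \<le> (1 + \<rho> * \<delta> / 2) * N\<^sup>2"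
      by (simp add: algebra_simps)
    then show ?thesis using \<rho>\<delta> by (simp add: r_def N_def field_simps)
  qed
  have "(norm (V T x))\<^sup>2 \<le> r * (norm x)\<^sup>2" for x
  proof (rule dense_domain_induct[OF V.domain_dense, where P = "\<lambda>x. (norm (V T x))\<^sup>2 \<le> r * (norm x)\<^sup>2"])
    show "closed {x. (norm (V T x))\<^sup>2 \<le> r * (norm x)\<^sup>2}"
      using pos by (intro closed_Collect_le continuous_intros linear_continuous_on V.semigroup_linear) auto
  qed (rule dom)
  then have "norm (V T x) \<le> sqrt r * norm x" for x
    using real_sqrt_le_mono[of "(norm (V T x))\<^sup>2" "r * (norm x)\<^sup>2"] by (simp add: real_sqrt_mult)
  then show ?thesis
    using r pos by (intro V.exponentially_stableI[of T "sqrt r"]) auto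
qed

theorem mainTheorem2:
  fixes A :: "('x::complex_hilbert \<times> 'x) set"
    and S :: "real \<Rightarrow> 'x \<Rightarrow> 'x"
    and lam :: complex
    and j :: "'x \<Rightarrow> 'y::complex_banach"
    and Am1 B :: "'x \<Rightarrow> 'y"
    and Sm1 :: "real \<Rightarrow> 'y \<Rightarrow> 'y"
    and W :: "'y set"
    and T p \<delta> :: real
  assumes "contraction_semigroup S"
    and "A = generator S"
    and "extrapolation_space A lam j"
    and "operator_extension j A Am1"
    and "semigroup_extension j S Sm1"
    and "bounded_clinear B"
    and "direct_decomposition j W"
    and "\<exists>\<rho>\<^sub>0>0. \<forall>\<rho>. 0 < \<rho> \<and> \<rho> < \<rho>\<^sub>0 \<longrightarrow>
           admissible_decomposition j W Am1 (\<lambda>x. - (\<rho> *\<^sub>R B x))"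
    and "T > 0" and "1 < p"
    and "p_admissible p T j Sm1 B"
    and "\<delta> > 0"
    and "\<And>x. integral {0..T} (\<lambda>t. Re (cinner (X_comp j W B (S t x)) (S t x)))
           \<ge> \<delta> * (norm (S T x))\<^sup>2"
  shows "\<exists>\<rho>\<^sub>1>0. \<forall>\<rho>. 0 < \<rho> \<and> \<rho> < \<rho>\<^sub>1 \<longrightarrow>
           (\<exists>V. C0_semigroup V \<and> generator V = part_in j (\<lambda>x. Am1 x - \<rho> *\<^sub>R B x) \<and>
                exponentially_stable V)"
proof -
  have contraction: "contraction_semigroup S" by fact
  obtain \<rho>\<^sub>0 where \<rho>\<^sub>0: "0 < \<rho>\<^sub>0"
    "\<And>\<rho>. 0 < \<rho> \<Longrightarrow> \<rho> < \<rho>\<^sub>0 \<Longrightarrow> admissible_decomposition j W Am1 (\<lambda>x. - (\<rho> *\<^sub>R B x))"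
    using assms(8) by blast
  interpret control_system S lam j Am1 Sm1 B
    using assms by unfold_locales simp_all
  have inj: "inj j" by (simp add: inj_def inj_j)
  obtain M where wb: "weighted_bound M"
    using ex_weighted_bound[of T p] assms(9,10,11) by auto
  then have M: "0 \<le> M" by (simp add: weighted_bound_def)
  let ?Q = "X_comp j W B"
  have Q: "bounded_linear ?Q"
    using \<rho>\<^sub>0(1) by (intro X_comp_dissipative(1)[OF j_clinear inj assms(7) \<rho>\<^sub>0(2)[of "\<rho>\<^sub>0 / 2"]]) simp_all
  \<comment> \<open>Once \<rho> M is at most 1/2, the factor 1 / (1 - \<rho> M) costs at most
    the 2 in \<kappa>.\<close>
  define \<kappa> where "\<kappa> = 2 * M * exp T"
  define k where "k = 6 * onorm ?Q * \<kappa> * T + 2 * \<delta> * \<kappa>\<^sup>2"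
  have \<kappa>: "0 \<le> \<kappa>" using M by (simp add: \<kappa>_def)
  have k: "0 \<le> k" using \<kappa> assms(9,12) onorm_pos_le[OF Q] by (simp add: k_def)
  \<comment> \<open>The successive bounds give an admissible decomposition, \<rho> \<le> 1,
    \<rho> M \<le> 1/2, \<rho> \<kappa> \<le> 1 and \<rho> k \<le> \<delta>/2.\<close>
  define \<rho>\<^sub>1 where "\<rho>\<^sub>1 = Min {\<rho>\<^sub>0, 1, 1 / (2 * (M + 1)), 1 / (\<kappa> + 1), \<delta> / (2 * (k + 1))}"
  have "0 < \<rho>\<^sub>1" using \<rho>\<^sub>0(1) M \<kappa> k assms(12) by (simp add: \<rho>\<^sub>1_def)
  moreover have "\<exists>V. C0_semigroup V \<and> generator V = part_in j (\<lambda>x. Am1 x - \<rho> *\<^sub>R B x) \<and> exponentially_stable V"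
    if \<rho>: "0 < \<rho>" "\<rho> < \<rho>\<^sub>1" for \<rho>
  proof -
    have lt: "\<rho> < \<rho>\<^sub>0" "\<rho> < 1" "\<rho> < 1 / (2 * (M + 1))" "\<rho> < 1 / (\<kappa> + 1)" "\<rho> < \<delta> / (2 * (k + 1))"
      using \<rho>(2) by (simp_all add: \<rho>\<^sub>1_def)
    have "\<rho> * (2 * (M + 1)) < 1" using lt(3) M by (simp add: pos_less_divide_eq)
    then have \<rho>M: "\<rho> * M \<le> 1 / 2" using \<rho>(1) by (simp add: algebra_simps)
    have "\<rho> * (\<kappa> + 1) < 1" using lt(4) \<kappa> by (simp add: pos_less_divide_eq)
    then have \<rho>\<kappa>: "\<rho> * \<kappa> \<le> 1" using \<rho>(1) by (simp add: algebra_simps)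
    have "\<rho> * (2 * (k + 1)) < \<delta>" using lt(5) k by (simp add: pos_less_divide_eq)
    then have \<rho>k: "\<rho> * k \<le> \<delta> / 2" using \<rho>(1) by (simp add: algebra_simps)
    interpret P: perturbed_system S lam j Am1 Sm1 B M \<rho>
      using wb \<rho>(1) \<rho>M by unfold_locales simp_all
    have close: "norm (P.V t x - S t x) \<le> \<rho> * \<kappa> * norm x" if t: "0 \<le> t" "t \<le> T" for t x
    proof -
      have "\<rho> * M / (1 - \<rho> * M) \<le> \<rho> * M / (1 / 2)"
        using \<rho>M \<rho>(1) M by (intro divide_left_mono) auto
      then have "\<rho> * M / (1 - \<rho> * M) * exp t \<le> (\<rho> * M / (1 / 2)) * exp T"
        using t \<rho>(1) M by (intro mult_mono) auto
      also have "\<dots> = \<rho> * \<kappa>" by (simp add: \<kappa>_def)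
      finally show ?thesis
        by (rule order_trans[OF P.V_minus_S[OF t(1)] mult_right_mono]) simp
    qed
    have diss: "Re (cinner y x) \<le> - \<rho> * Re (cinner (?Q x) x)" if "(x, y) \<in> generator P.V" for x y
      using that unfolding P.generator_V part_in_def
      by (intro X_comp_dissipative(2)[OF j_clinear inj assms(7) \<rho>\<^sub>0(2)[OF \<rho>(1) lt(1)] \<rho>(1)]) simp
    have "exponentially_stable P.V"
      using stable_of_observability[OF contraction P.V_growth_semigroup Q diss close assms(13)]
        assms(9,12) \<rho>(1) \<kappa> lt(2) \<rho>\<kappa> \<rho>k by (simp add: k_def)
    then show ?thesis using P.V.C0 P.generator_V by blast
  qed
  ultimately show ?thesis by blast
qed

end
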